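(* Let $v:\mathbb{R}_+\to\mathbb{R}_+$ be an admissible weight function, let $X$ be one of the Banach spaces $L^p_v(\mathbb{R}_+)$ (with $1\le p<\infty$) or $C_{0,v}(\mathbb{R}_+)$, and let $\mathcal{T}=\{T_t : t\in\mathbb{R}_+\}$ be the semigroup of left translation operators on $X$. The following are equivalent: (1) $\sup\left\{ \frac{v(x)}{v(y)} : x,y\in\mathbb{R}_+,\ y\ge x \right\}=\infty$. (2) For some $f\in X$, $\lim_{t\to\infty}T_tf\neq 0$ (that is, $T_tf$ does not converge to $0$ in $X$ as $t\to\infty$). (3) $\mathcal{T}$ is not uniformly bounded. (4) $\mathcal{T}$ is not uniformly equicontinuous. (5) $\mathcal{T}$ is not equicontinuous. (6) $\mathcal{T}$ has nonzero topological entropy, i.e. $h(\mathcal{T})\neq 0$. (7) $\mathcal{T}$ has infinite topological entropy, i.e. $h(\mathcal{T})=\infty$.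
   Context: Notation: $\mathbb{R}_+=[0,\infty)$. Admissible weight function: a function $v:\mathbb{R}_+\to\mathbb{R}_+$ that is strictly positive, locally integrable, and such that there exist $M\ge 1$ and $w\in\mathbb{R}_+$ with $v(x)\le Me^{wt}v(x+t)$ for all $x,t\ge 0$. $L^p_v(\mathbb{R}_+)$ is the space of (Lebesgue measurable) $f:\mathbb{R}_+\to\mathbb{R}$ with $\int_0^\infty |f(x)|^pv(x)\,dx<\infty$, functions equal Lebesgue almost everywhere being identified, with norm $\|f\|=\left(\int_0^\infty|f(x)|^pv(x)\,dx\right)^{1/p}$. $C_{0,v}(\mathbb{R}_+)$ is the space of continuous $f:\mathbb{R}_+\to\mathbb{R}$ with $\lim_{x\to\infty}|f(x)|v(x)=0$, with norm $\|f\|=\sup\{|f(x)|v(x):x\in\mathbb{R}_+\}$. Both are Banach spaces, and $d(f,g)=\|f-g\|$ denotes the norm metric. Left translation operators: for $t\ge 0$, $T_t:X\to X$ is $(T_tf)(x)=f(x+t)$ for all $x\ge 0$. Each $T_t$ is a continuous linear operator on $X$. Uniformly bounded: there is $B\ge 0$ such that $\|T f\|\le B\|f\|$ for all $f\in X$ and $T\in\mathcal{T}$. Equicontinuous: for every $\varepsilon>0$ and $f\in X$ there is $\delta>0$ such that for all $T\in\mathcal{T}$ and $g\in X$, $d(f,g)<\delta$ implies $d(Tf,Tg)<\varepsilon$. Uniformly equicontinuous: for every $\varepsilon>0$ there is $\delta>0$ such that for all $T\in\mathcal{T}$ and $f,g\in X$, $d(f,g)<\delta$ implies $d(Tf,Tg)<\varepsilon$.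 Topological entropy: for compact $K\subseteq X$, $t>0$, $\varepsilon>0$, a set $S\subseteq K$ is $(t,\varepsilon)$-separated if for all distinct $f,g\in S$ there is $u\in[0,t]$ with $d(T_uf,T_ug)\ge\varepsilon$. Let $s_{t,\varepsilon}(\mathcal{T},K)$ be the largest cardinality of a $(t,\varepsilon)$-separated subset of $K$. Set $h(\mathcal{T},K)=\lim_{\varepsilon\to 0}\limsup_{t\to\infty}\frac1t\log s_{t,\varepsilon}(\mathcal{T},K)$ and $h(\mathcal{T})=\sup\{h(\mathcal{T},K):K\subseteq X\text{ compact}\}$. *)

theory Defs
  imports "HOL-Analysis.Analysis"
begin

(* A function on [0,\<infinity>) is given by a total function real \<Rightarrow> real of which only the values
   on {0..} are ever used. *)

definition admissible_weight :: "(real \<Rightarrow> real) \<Rightarrow> bool" where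
  "admissible_weight v \<longleftrightarrow>
     (\<forall>x\<ge>0. v x > 0) \<and>
     (\<forall>K. compact K \<and> K \<subseteq> {0..} \<longrightarrow> v absolutely_integrable_on K) \<and>
     (\<exists>M\<ge>1. \<exists>w\<ge>0. \<forall>x\<ge>0. \<forall>t\<ge>0. v x \<le> M * exp (w * t) * v (x + t))"

(* A space of functions on [0,\<infinity>) up to identification: the points of the space are the
   classes of members of funs under ident, and fnorm is the norm on representatives. *)

record function_space =
  funs :: "(real \<Rightarrow> real) set"
  ident :: "(real \<Rightarrow> real) \<Rightarrow> (real \<Rightarrow> real) \<Rightarrow> bool"
  fnorm :: "(real \<Rightarrow> real) \<Rightarrow> real"

definition Lp_space :: "real \<Rightarrow> (real \<Rightarrow> real) \<Rightarrow> function_space" where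
  "Lp_space p v =
     \<lparr> funs = {f. f \<in> borel_measurable (lebesgue_on {0..}) \<and>
                  integrable (lebesgue_on {0..}) (\<lambda>x. \<bar>f x\<bar> powr p * v x)},
       ident = (\<lambda>f g. AE x in lebesgue_on {0..}. f x = g x),
       fnorm = (\<lambda>f. (LINT x|lebesgue_on {0..}. \<bar>f x\<bar> powr p * v x) powr (1 / p)) \<rparr>"

(* Identifying functions that agree on {0..} only discards the irrelevant values on x < 0. *)

definition C0_space :: "(real \<Rightarrow> real) \<Rightarrow> function_space" where
  "C0_space v =
     \<lparr> funs = {f. continuous_on {0..} f \<and> ((\<lambda>x. \<bar>f x\<bar> * v x) \<longlongrightarrow> 0) at_top},
       ident = (\<lambda>f g. \<forall>x\<ge>0. f x = g x),
       fnorm = (\<lambda>f. SUP x\<in>{0..}. \<bar>f x\<bar> * v x) \<rparr>"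

type_synonym point = "(real \<Rightarrow> real) set"

definition ident_rel :: "function_space \<Rightarrow> ((real \<Rightarrow> real) \<times> (real \<Rightarrow> real)) set" where
  "ident_rel X = {(f, g). f \<in> funs X \<and> g \<in> funs X \<and> ident X f g}"

definition points :: "function_space \<Rightarrow> point set" where
  "points X = funs X // ident_rel X"

definition cls :: "function_space \<Rightarrow> (real \<Rightarrow> real) \<Rightarrow> point" where
  "cls X f = ident_rel X `` {f}"

definition rep :: "point \<Rightarrow> real \<Rightarrow> real" where
  "rep F = (SOME f. f \<in> F)"

definition pzero :: "function_space \<Rightarrow> point" where
  "pzero X = cls X (\<lambda>x. 0)"

definition pminus :: "function_space \<Rightarrow> point \<Rightarrow> point \<Rightarrow> point" where
  "pminus X F G = cls X (\<lambda>x. rep F x - rep G x)"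

definition pnorm :: "function_space \<Rightarrow> point \<Rightarrow> real" where
  "pnorm X F = fnorm X (rep F)"

(* The value 0 outside the space is only there because Metric_space asks for a function that
   is nonnegative and symmetric on the whole type. *)

definition pdist :: "function_space \<Rightarrow> point \<Rightarrow> point \<Rightarrow> real" where
  "pdist X F G = (if F \<in> points X \<and> G \<in> points X then pnorm X (pminus X F G) else 0)"

definition norm_topology :: "function_space \<Rightarrow> point topology" where
  "norm_topology X = Metric_space.mtopology (points X) (pdist X)"

definition left_translation :: "function_space \<Rightarrow> real \<Rightarrow> point \<Rightarrow> point" where
  "left_translation X t F = cls X (\<lambda>x. rep F (x + t))"

definition translation_semigroup :: "function_space \<Rightarrow> (point \<Rightarrow> point) set" where
  "translation_semigroup X = left_translation X ` {0..}"

definition uniformly_bounded :: "function_space \<Rightarrow> (point \<Rightarrow> point) set \<Rightarrow> bool" where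
  "uniformly_bounded X TT \<longleftrightarrow>
     (\<exists>B\<ge>0. \<forall>f\<in>points X. \<forall>T\<in>TT. pnorm X (T f) \<le> B * pnorm X f)"

definition equicontinuous :: "function_space \<Rightarrow> (point \<Rightarrow> point) set \<Rightarrow> bool" where
  "equicontinuous X TT \<longleftrightarrow>
     (\<forall>\<epsilon>>0. \<forall>f\<in>points X. \<exists>\<delta>>0. \<forall>T\<in>TT. \<forall>g\<in>points X.
        pdist X f g < \<delta> \<longrightarrow> pdist X (T f) (T g) < \<epsilon>)"

definition uniformly_equicontinuous :: "function_space \<Rightarrow> (point \<Rightarrow> point) set \<Rightarrow> bool" where
  "uniformly_equicontinuous X TT \<longleftrightarrow>
     (\<forall>\<epsilon>>0. \<exists>\<delta>>0. \<forall>T\<in>TT. \<forall>f\<in>points X. \<forall>g\<in>points X.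
        pdist X f g < \<delta> \<longrightarrow> pdist X (T f) (T g) < \<epsilon>)"

definition separated :: "function_space \<Rightarrow> real \<Rightarrow> real \<Rightarrow> point set \<Rightarrow> bool" where
  "separated X t \<epsilon> S \<longleftrightarrow>
     (\<forall>f\<in>S. \<forall>g\<in>S. f \<noteq> g \<longrightarrow>
        (\<exists>u\<in>{0..t}. pdist X (left_translation X u f) (left_translation X u g) \<ge> \<epsilon>))"

(* The supremum is over finite sets because card is 0 on infinite ones; an infinite separated
   set has finite separated subsets of every size and so makes it \<infinity>. *)

definition max_separated :: "function_space \<Rightarrow> real \<Rightarrow> real \<Rightarrow> point set \<Rightarrow> enat" where
  "max_separated X t \<epsilon> K =
     (SUP S\<in>{S. S \<subseteq> K \<and> finite S \<and> separated X t \<epsilon> S}. enat (card S))"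

definition log_enat :: "enat \<Rightarrow> ereal" where
  "log_enat n = (case n of enat k \<Rightarrow> if k = 0 then -\<infinity> else ereal (ln (real k)) | \<infinity> \<Rightarrow> \<infinity>)"

definition entropy_on :: "function_space \<Rightarrow> point set \<Rightarrow> ereal" where
  "entropy_on X K =
     Lim (at_right 0) (\<lambda>\<epsilon>::real.
       Limsup at_top (\<lambda>t::real. ereal (1 / t) * log_enat (max_separated X t \<epsilon> K)))"

definition topological_entropy :: "function_space \<Rightarrow> ereal" where
  "topological_entropy X = (SUP K\<in>{K. compactin (norm_topology X) K}. entropy_on X K)"

definition all_equivalent :: "bool list \<Rightarrow> bool" where
  "all_equivalent Ps \<longleftrightarrow> (\<forall>P\<in>set Ps. \<forall>Q\<in>set Ps. P \<longleftrightarrow> Q)"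

end

theory Submission
  imports Defs
begin

text \<open>Write \<open>R\<close> for the supremum of \<open>v x / v y\<close> over \<open>0 \<le> x \<le> y\<close>. After the substitution
\<open>y = x + t\<close>, the norm of \<open>T\<^sub>t f\<close> differs from the norm of \<open>f\<close> restricted to \<open>[t, \<infinity>)\<close> only in that
the weight \<open>v y\<close> is replaced by \<open>v (y - t)\<close>. If \<open>R < \<infinity>\<close>, the norm of every translation is therefore
at most \<open>R powr q\<close>, where \<open>q = 1 / p\<close> for \<open>L\<^sup>p\<close> and \<open>q = 1\<close> for \<open>C\<^sub>0\<close>, and every orbit tends to \<open>0\<close>
because the tails of \<open>f\<close> do. A uniformly bounded semigroup is uniformly equicontinuous, and a fixed
finite net of a compact set bounds the size of its separated subsets independently of the time,
so the entropy vanishes (\<open>entropy_eq_0\<close>).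

If \<open>R = \<infinity>\<close>, choose \<open>x \<le> y\<close> with \<open>v x / v y\<close> huge. The growth condition makes \<open>v\<close> comparable to
\<open>v x\<close> on \<open>[x, x + 1]\<close> and to \<open>v y\<close> on \<open>[y - 1, y]\<close>, and forces \<open>y - x\<close> to be large. Functions supported
in \<open>[y - 1, y]\<close> are therefore expanded by a huge factor by the translation by \<open>t = y - 1 - x\<close>. There is
room in this interval for any number \<open>n\<close> of disjoint bumps, all of small norm, whose translates have
norm at least \<open>1\<close> and are hence at distance at least \<open>1\<close> from each other (\<open>expanding_bumps\<close>).
Since \<open>n\<close> is independent of \<open>t\<close>, it can be taken larger than \<open>exp (t\<^sup>2)\<close>; a sequence of such finite sets
shrinking to \<open>0\<close>, together with \<open>0\<close>, is a compact set of infinite entropy (\<open>entropy_eq_infinity\<close>).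
Two such bumps already violate equicontinuity at \<open>0\<close>, and a common majorant of a summable sequence
of nonnegative bumps has an orbit that does not tend to \<open>0\<close> (\<open>nonvanishing_orbit\<close>).

Everything except the estimates in the two function spaces is carried out once, in the locale
\<open>weighted_translation_space\<close>.\<close>

section \<open>Separated sets, entropy and compactness\<close>

lemma max_separated_ge:
  assumes "S \<subseteq> K" "finite S" "separated X t e S"
  shows "enat (card S) \<le> max_separated X t e K"
  unfolding max_separated_def using assms by (intro SUP_upper) auto

lemma Lim_at_right_0_eqI:
  assumes "\<And>e. 0 < e \<Longrightarrow> e < 1 \<Longrightarrow> f e = l"
  shows "Lim (at_right (0::real)) f = (l :: ereal)"
proof -
  have "\<forall>\<^sub>F e in at_right (0::real). l = f e"
    using assms eventually_at_right_less[of 0] eventually_at_rightI[of 0 1 "\<lambda>e. l = f e"] by auto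
  then have "(f \<longlongrightarrow> l) (at_right 0)"
    by (rule Lim_transform_eventually[OF tendsto_const])
  then show ?thesis
    by (intro tendsto_Lim) auto
qed

text \<open>The empty set is compact and contributes \<open>-\<infinity>\<close>, because its only separated subset has \<open>0\<close> elements
and the logarithm of \<open>0\<close> is \<open>-\<infinity>\<close>.\<close>

lemma entropy_on_empty: "entropy_on X {} = -\<infinity>"
  unfolding entropy_on_def
proof (rule Lim_at_right_0_eqI)
  fix e :: real
  have "{S. S \<subseteq> {} \<and> finite S \<and> separated X t e S} = {{}}" for t
    by (auto simp: separated_def)
  then have "max_separated X t e {} = 0" for t
    by (simp add: max_separated_def enat_0)
  then have *: "log_enat (max_separated X t e {}) = -\<infinity>" for t
    by (simp add: log_enat_def zero_enat_def)
  have "Limsup at_top (\<lambda>t::real. ereal (1 / t) * log_enat (max_separated X t e {}))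
      = Limsup at_top (\<lambda>t::real. -\<infinity> :: ereal)"
    by (intro Limsup_eq eventually_mono[OF eventually_gt_at_top[of 0]]) (simp add: *)
  then show "Limsup at_top (\<lambda>t. ereal (1 / t) * log_enat (max_separated X t e {})) = -\<infinity>"
    by (simp add: Limsup_const)
qed

context Metric_space
begin

lemma compactin_null_sequence_of_finite_sets:
  assumes "z \<in> M" "\<And>k. finite (A k)" "\<And>k. A k \<subseteq> M"
    and small: "\<And>e. 0 < e \<Longrightarrow> \<forall>\<^sub>F k in sequentially. \<forall>F\<in>A k. d z F < e"
  shows "compactin mtopology (insert z (\<Union>k::nat. A k))"
  unfolding compactin_def
proof (intro conjI allI impI)
  show "insert z (\<Union> (range A)) \<subseteq> topspace mtopology"
    using assms by auto
  fix \<U> assume \<U>: "Ball \<U> (openin mtopology) \<and> insert z (\<Union> (range A)) \<subseteq> \<Union> \<U>"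
  then obtain U where U: "U \<in> \<U>" "z \<in> U" "openin mtopology U"
    by blast
  then obtain r where r: "0 < r" "mball z r \<subseteq> U"
    unfolding openin_mtopology by blast
  obtain n where n: "\<And>k. n \<le> k \<Longrightarrow> A k \<subseteq> mball z r"
    using small[OF r(1)] assms(1,3) unfolding eventually_sequentially by (auto 5 0 simp: subset_iff)
  have fin: "finite (\<Union>k<n. A k)"
    using assms(2) by simp
  have "\<forall>F\<in>(\<Union>k<n. A k). \<exists>V\<in>\<U>. F \<in> V"
    using \<U> by blast
  then obtain V where V: "\<And>F. F \<in> (\<Union>k<n. A k) \<Longrightarrow> V F \<in> \<U> \<and> F \<in> V F"
    by metis
  have "A k \<subseteq> \<Union> (insert U (V ` (\<Union>k<n. A k)))" for k
  proof (cases "k < n")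
    case True
    then show ?thesis
      using V by blast
  next
    case False
    then show ?thesis
      using n[of k] r(2) by auto
  qed
  then show "\<exists>\<F>. finite \<F> \<and> \<F> \<subseteq> \<U> \<and> insert z (\<Union> (range A)) \<subseteq> \<Union> \<F>"
    using fin V U by (intro exI[of _ "insert U (V ` (\<Union>k<n. A k))"]) blast
qed

end

section \<open>Quotient norm and translation on classes of functions\<close>

abbreviation (input) shift :: "real \<Rightarrow> (real \<Rightarrow> real) \<Rightarrow> real \<Rightarrow> real" where
  "shift t f \<equiv> (\<lambda>x. f (x + t))"

text \<open>A space of functions with a seminorm whose null elements are the differences of identified
functions. The last assumption makes translation compatible with the identification; in \<open>L\<^sup>p\<close> this
replaces an argument about translates of null sets.\<close>

locale translation_space =
  fixes X :: function_space
  assumes zero_mem: "(\<lambda>x. 0) \<in> funs X"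
    and diff_mem: "f \<in> funs X \<Longrightarrow> g \<in> funs X \<Longrightarrow> (\<lambda>x. f x - g x) \<in> funs X"
    and shift_mem: "f \<in> funs X \<Longrightarrow> 0 \<le> t \<Longrightarrow> shift t f \<in> funs X"
    and fnorm_nonneg: "f \<in> funs X \<Longrightarrow> 0 \<le> fnorm X f"
    and fnorm_zero: "fnorm X (\<lambda>x. 0) = 0"
    and fnorm_diff_le: "f \<in> funs X \<Longrightarrow> g \<in> funs X \<Longrightarrow>
           fnorm X (\<lambda>x. f x - g x) \<le> fnorm X f + fnorm X g"
    and ident_iff: "f \<in> funs X \<Longrightarrow> g \<in> funs X \<Longrightarrow>
           ident X f g \<longleftrightarrow> fnorm X (\<lambda>x. f x - g x) = 0"
    and shift_bounded: "0 \<le> t \<Longrightarrow> \<exists>c. \<forall>f\<in>funs X. fnorm X (shift t f) \<le> c * fnorm X f"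
begin

lemma fnorm_diff_commute_le:
  assumes "f \<in> funs X" "g \<in> funs X"
  shows "fnorm X (\<lambda>x. g x - f x) \<le> fnorm X (\<lambda>x. f x - g x)"
  using fnorm_diff_le[OF zero_mem diff_mem[OF assms]] fnorm_zero by simp

lemma fnorm_diff_commute:
  assumes "f \<in> funs X" "g \<in> funs X"
  shows "fnorm X (\<lambda>x. f x - g x) = fnorm X (\<lambda>x. g x - f x)"
  using fnorm_diff_commute_le assms by (intro order_antisym) auto

lemma fnorm_triangle:
  assumes "f \<in> funs X" "g \<in> funs X" "h \<in> funs X"
  shows "fnorm X (\<lambda>x. f x - h x) \<le> fnorm X (\<lambda>x. f x - g x) + fnorm X (\<lambda>x. g x - h x)"
  using fnorm_diff_le[OF diff_mem[of f g] diff_mem[of h g]] assms fnorm_diff_commute[of h g]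
  by simp

lemma fnorm_le_diff:
  assumes "f \<in> funs X" "g \<in> funs X"
  shows "fnorm X f \<le> fnorm X (\<lambda>x. f x - g x) + fnorm X g"
  using fnorm_triangle[of f g "\<lambda>x. 0"] assms zero_mem by simp

lemma fnorm_cong:
  assumes "f \<in> funs X" "g \<in> funs X" "fnorm X (\<lambda>x. f x - g x) = 0"
  shows "fnorm X f = fnorm X g"
  using fnorm_le_diff[of f g] fnorm_le_diff[of g f] fnorm_diff_commute[of f g] assms by simp

lemma fnorm_shift_eq_0:
  assumes "f \<in> funs X" "fnorm X f = 0" "0 \<le> t"
  shows "fnorm X (shift t f) = 0"
proof -
  obtain c where "\<forall>f\<in>funs X. fnorm X (shift t f) \<le> c * fnorm X f"
    using shift_bounded[OF assms(3)] by blast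
  then have "fnorm X (shift t f) \<le> 0"
    using assms by force
  then show ?thesis
    using fnorm_nonneg[OF shift_mem[OF assms(1,3)]] by simp
qed

lemma equiv_ident: "equiv (funs X) (ident_rel X)"
proof (rule equivI)
  show "ident_rel X \<subseteq> funs X \<times> funs X"
    by (auto simp: ident_rel_def)
  show "refl_on (funs X) (ident_rel X)"
    by (auto simp: refl_on_def ident_rel_def ident_iff fnorm_zero)
  show "sym (ident_rel X)"
    by (auto simp: sym_def ident_rel_def ident_iff) (metis fnorm_diff_commute)
  show "trans (ident_rel X)"
  proof (rule transI)
    fix f g h assume "(f, g) \<in> ident_rel X" "(g, h) \<in> ident_rel X"
    then have *: "f \<in> funs X" "g \<in> funs X" "h \<in> funs X"
      "fnorm X (\<lambda>x. f x - g x) = 0" "fnorm X (\<lambda>x. g x - h x) = 0"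
      by (auto simp: ident_rel_def ident_iff)
    then have "fnorm X (\<lambda>x. f x - h x) = 0"
      using fnorm_triangle[of f g h] fnorm_nonneg[OF diff_mem[of f h]] by auto
    then show "(f, h) \<in> ident_rel X"
      using * by (simp add: ident_rel_def ident_iff)
  qed
qed

lemma cls_eq_iff:
  assumes "f \<in> funs X" "g \<in> funs X"
  shows "cls X f = cls X g \<longleftrightarrow> fnorm X (\<lambda>x. f x - g x) = 0"
  using eq_equiv_class_iff[OF equiv_ident assms] assms
  by (simp add: cls_def ident_rel_def ident_iff)

lemma points_eq: "points X = cls X ` funs X"
  by (auto simp: points_def quotient_def cls_def)

lemma cls_in_points: "f \<in> funs X \<Longrightarrow> cls X f \<in> points X"
  by (simp add: points_eq)

lemma rep_cls:
  assumes "f \<in> funs X"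
  shows "rep (cls X f) \<in> funs X" "fnorm X (\<lambda>x. rep (cls X f) x - f x) = 0"
proof -
  have "f \<in> cls X f"
    using equiv_class_self[OF equiv_ident assms] by (simp add: cls_def)
  then have "rep (cls X f) \<in> cls X f"
    unfolding rep_def by (rule someI[of "\<lambda>g. g \<in> cls X f"])
  then have *: "rep (cls X f) \<in> funs X" "fnorm X (\<lambda>x. f x - rep (cls X f) x) = 0"
    using assms by (auto simp: cls_def ident_rel_def ident_iff)
  then show "rep (cls X f) \<in> funs X" "fnorm X (\<lambda>x. rep (cls X f) x - f x) = 0"
    using fnorm_diff_commute[OF assms *(1)] by simp_all
qed

lemma pnorm_cls: "f \<in> funs X \<Longrightarrow> pnorm X (cls X f) = fnorm X f"
  unfolding pnorm_def by (intro fnorm_cong rep_cls)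

lemma pminus_cls:
  assumes "f \<in> funs X" "g \<in> funs X"
  shows "pminus X (cls X f) (cls X g) = cls X (\<lambda>x. f x - g x)"
proof -
  let ?f = "rep (cls X f)" and ?g = "rep (cls X g)"
  note r = rep_cls[OF assms(1)] rep_cls[OF assms(2)]
  have "fnorm X (\<lambda>x. (?f x - f x) - (?g x - g x)) \<le>
      fnorm X (\<lambda>x. ?f x - f x) + fnorm X (\<lambda>x. ?g x - g x)"
    using assms r by (intro fnorm_diff_le diff_mem)
  then have "fnorm X (\<lambda>x. (?f x - ?g x) - (f x - g x)) \<le> 0"
    using r by (simp add: algebra_simps)
  then have "fnorm X (\<lambda>x. (?f x - ?g x) - (f x - g x)) = 0"
    using fnorm_nonneg[OF diff_mem[OF diff_mem diff_mem]] assms r by (intro order_antisym) auto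
  then show ?thesis
    unfolding pminus_def using assms r by (subst cls_eq_iff) (auto intro: diff_mem)
qed

lemma pdist_cls:
  assumes "f \<in> funs X" "g \<in> funs X"
  shows "pdist X (cls X f) (cls X g) = fnorm X (\<lambda>x. f x - g x)"
  using assms by (simp add: pdist_def cls_in_points pminus_cls pnorm_cls diff_mem)

lemma left_translation_cls:
  assumes "f \<in> funs X" "0 \<le> t"
  shows "left_translation X t (cls X f) = cls X (shift t f)"
  using assms rep_cls[OF assms(1)] fnorm_shift_eq_0[of "\<lambda>x. rep (cls X f) x - f x" t]
  unfolding left_translation_def by (subst cls_eq_iff) (auto intro: shift_mem diff_mem)

lemma Metric_space_points: "Metric_space (points X) (pdist X)"
proof
  fix F G H :: point
  show nonneg: "0 \<le> pdist X F G"
  proof (cases "F \<in> points X \<and> G \<in> points X")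
    case True
    then show ?thesis
      by (auto simp: points_eq pdist_cls intro!: fnorm_nonneg diff_mem)
  qed (auto simp: pdist_def)
  show "pdist X F G = pdist X G F"
  proof (cases "F \<in> points X \<and> G \<in> points X")
    case True
    then show ?thesis
      by (auto simp: points_eq pdist_cls intro: fnorm_diff_commute)
  qed (auto simp: pdist_def)
  assume F: "F \<in> points X" and G: "G \<in> points X"
  show "pdist X F G = 0 \<longleftrightarrow> F = G"
  proof -
    obtain f g where "f \<in> funs X" "F = cls X f" "g \<in> funs X" "G = cls X g"
      using F G unfolding points_eq by blast
    then show ?thesis
      by (simp add: pdist_cls cls_eq_iff)
  qed
  assume H: "H \<in> points X"
  show "pdist X F H \<le> pdist X F G + pdist X G H"
    using F G H by (auto simp: points_eq pdist_cls fnorm_triangle)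
qed

sublocale Metric_space "points X" "pdist X"
  by (rule Metric_space_points)

lemma norm_topology_eq: "norm_topology X = mtopology"
  by (simp add: norm_topology_def)

lemma pzero_in_points: "pzero X \<in> points X"
  by (simp add: pzero_def cls_in_points zero_mem)

lemma limitin_zero_iff:
  assumes "f \<in> funs X"
  shows "limitin (norm_topology X) (\<lambda>t. left_translation X t (cls X f)) (pzero X) at_top \<longleftrightarrow>
    ((\<lambda>t. fnorm X (shift t f)) \<longlongrightarrow> 0) at_top"
proof -
  have *: "left_translation X t (cls X f) \<in> points X \<and>
      pdist X (left_translation X t (cls X f)) (pzero X) = fnorm X (shift t f)"
    if "0 \<le> t" for t
    using assms that
    by (simp add: left_translation_cls pzero_def pdist_cls shift_mem zero_mem cls_in_points)
  have "(\<forall>\<^sub>F t in at_top. left_translation X t (cls X f) \<in> points X \<and>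
      pdist X (left_translation X t (cls X f)) (pzero X) < e) \<longleftrightarrow>
      (\<forall>\<^sub>F t in at_top. dist (fnorm X (shift t f)) 0 < e)" for e :: real
    by (rule eventually_cong[OF eventually_ge_at_top[of 0]])
      (use * assms in \<open>auto simp: fnorm_nonneg shift_mem\<close>)
  then show ?thesis
    by (simp add: norm_topology_eq limitin_metric pzero_in_points tendsto_iff)
qed

section \<open>Entropy of a bounded translation semigroup\<close>

lemma pdist_translation:
  assumes "f \<in> funs X" "g \<in> funs X" "0 \<le> t"
  shows "pdist X (left_translation X t (cls X f)) (left_translation X t (cls X g))
    = fnorm X (shift t (\<lambda>x. f x - g x))"
  using assms by (simp add: left_translation_cls pdist_cls shift_mem)

text \<open>If translations are \<open>B\<close>-Lipschitz, two points in the same ball of radius \<open>d\<close> stay closer than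
\<open>2 * B * d\<close> forever. A separated set hence has at most as many points as a finite net of \<open>K\<close>, a number
independent of the time, and its logarithm divided by the time tends to \<open>0\<close>.\<close>

lemma entropy_on_eq_0:
  assumes B: "\<And>f t. f \<in> funs X \<Longrightarrow> 0 \<le> t \<Longrightarrow> fnorm X (shift t f) \<le> B * fnorm X f"
    and K: "compactin (norm_topology X) K" "K \<noteq> {}"
  shows "entropy_on X K = 0"
  unfolding entropy_on_def
proof (rule Lim_at_right_0_eqI)
  fix e :: real assume e: "0 < e"
  define c where "c = \<bar>B\<bar> + 1"
  define d where "d = e / (2 * c)"
  have c: "0 < c" "\<bar>B\<bar> < c"
    by (simp_all add: c_def)
  have d: "0 < d"
    using e c by (simp add: d_def)
  have "c * (2 * d) = e"
    using c by (simp add: d_def)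
  then have Bd: "\<bar>B\<bar> * (2 * d) < e"
    using mult_strict_right_mono[OF c(2), of "2 * d"] d by simp
  have KX: "K \<subseteq> points X"
    using compactin_subset_topspace[OF K(1)] by (simp add: norm_topology_eq)
  obtain Q where Q: "finite Q" "Q \<subseteq> K" "K \<subseteq> (\<Union>x\<in>Q. mball x d)"
    using compactin_imp_mtotally_bounded[OF K(1)[unfolded norm_topology_eq]] d
    unfolding mtotally_bounded_def by meson
  have upper: "max_separated X t e K \<le> enat (card Q)" for t
    unfolding max_separated_def
  proof (rule SUP_least)
    fix S assume "S \<in> {S. S \<subseteq> K \<and> finite S \<and> separated X t e S}"
    then have S: "S \<subseteq> K" "finite S" "separated X t e S"
      by auto
    have "\<forall>F\<in>S. \<exists>q\<in>Q. pdist X q F < d"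
      using Q(3) S(1) by fastforce
    then obtain q where q: "\<And>F. F \<in> S \<Longrightarrow> q F \<in> Q \<and> pdist X (q F) F < d"
      by metis
    have "inj_on q S"
    proof (rule inj_onI, rule ccontr)
      fix F G assume FG: "F \<in> S" "G \<in> S" "q F = q G" "F \<noteq> G"
      then obtain u where u: "0 \<le> u"
        "e \<le> pdist X (left_translation X u F) (left_translation X u G)"
        using S(3) unfolding separated_def by fastforce
      obtain f g where fg: "f \<in> funs X" "F = cls X f" "g \<in> funs X" "G = cls X g"
        using FG S(1) KX unfolding points_eq by blast
      have "q F \<in> points X" "F \<in> points X" "G \<in> points X"
        using q[OF FG(1)] Q(2) KX S(1) FG(1,2) by blast+
      then have "pdist X F G < 2 * d"
        using triangle[of F "q F" G] q[OF FG(1)] q[OF FG(2)] FG(3) commute[of F "q F"] by simp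
      then have "fnorm X (\<lambda>x. f x - g x) < 2 * d"
        using fg by (simp add: pdist_cls)
      then have *: "\<bar>B\<bar> * fnorm X (\<lambda>x. f x - g x) \<le> \<bar>B\<bar> * (2 * d)"
        by (intro mult_left_mono) auto
      have "e \<le> B * fnorm X (\<lambda>x. f x - g x)"
        using B[OF diff_mem[OF fg(1,3)] u(1)] u pdist_translation[OF fg(1,3) u(1)] fg by simp
      also have "\<dots> \<le> \<bar>B\<bar> * fnorm X (\<lambda>x. f x - g x)"
        using fnorm_nonneg[OF diff_mem[OF fg(1,3)]] by (intro mult_right_mono) auto
      finally show False
        using * Bd by simp
    qed
    then have "card S \<le> card Q"
      using q Q(1) by (intro card_inj_on_le) auto
    then show "enat (card S) \<le> enat (card Q)"
      by simp
  qed
  obtain F where "F \<in> K"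
    using K(2) by blast
  have lower: "enat 1 \<le> max_separated X t e K" for t
    using max_separated_ge[of "{F}" K X t e] \<open>F \<in> K\<close> by (simp add: separated_def)
  have bounds: "0 \<le> log_enat (max_separated X t e K) \<and>
      log_enat (max_separated X t e K) \<le> ereal (ln (real (card Q)))" for t
    using upper[of t] lower[of t] by (cases "max_separated X t e K") (auto simp: log_enat_def)
  have "((\<lambda>t::real. 1 / t * ln (real (card Q))) \<longlongrightarrow> 0) at_top"
    by (rule tendsto_mult_left_zero) (intro tendsto_divide_0[OF tendsto_const] filterlim_at_top_imp_at_infinity filterlim_ident)
  then have lim: "((\<lambda>t::real. ereal (1 / t) * ereal (ln (real (card Q)))) \<longlongrightarrow> 0) at_top"
    by (simp add: zero_ereal_def)
  have "((\<lambda>t. ereal (1 / t) * log_enat (max_separated X t e K)) \<longlongrightarrow> 0) at_top"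
  proof (rule tendsto_sandwich[OF _ _ tendsto_const lim])
    show "\<forall>\<^sub>F t::real in at_top. 0 \<le> ereal (1 / t) * log_enat (max_separated X t e K)"
      using eventually_gt_at_top[of 0] by eventually_elim (use bounds in simp)
    show "\<forall>\<^sub>F t::real in at_top. ereal (1 / t) * log_enat (max_separated X t e K)
        \<le> ereal (1 / t) * ereal (ln (real (card Q)))"
      using eventually_gt_at_top[of 0]
      by eventually_elim (rule ereal_mult_left_mono, use bounds in auto)
  qed
  then show "Limsup at_top (\<lambda>t. ereal (1 / t) * log_enat (max_separated X t e K)) = 0"
    by (intro lim_imp_Limsup) auto
qed

lemma entropy_eq_0:
  assumes "\<And>f t. f \<in> funs X \<Longrightarrow> 0 \<le> t \<Longrightarrow> fnorm X (shift t f) \<le> B * fnorm X f"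
  shows "topological_entropy X = 0"
  unfolding topological_entropy_def
proof (intro antisym SUP_least)
  fix K assume "K \<in> {K. compactin (norm_topology X) K}"
  then show "entropy_on X K \<le> 0"
    using entropy_on_eq_0[of B K] entropy_on_empty assms by (cases "K = {}") auto
next
  have K: "compactin (norm_topology X) {pzero X}"
    by (simp add: norm_topology_eq compactin_sing pzero_in_points)
  then have "entropy_on X {pzero X} = 0"
    using entropy_on_eq_0[of B] assms by simp
  then show "0 \<le> (SUP K\<in>{K. compactin (norm_topology X) K}. entropy_on X K)"
    using K by (intro SUP_upper2[of "{pzero X}"]) auto
qed

lemma not_uniformly_equicontinuous:
  assumes "\<not> equicontinuous X (translation_semigroup X)"
  shows "\<not> uniformly_equicontinuous X (translation_semigroup X)"
  using assms unfolding equicontinuous_def uniformly_equicontinuous_def by meson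

lemma uniformly_bounded_iff:
  "uniformly_bounded X (translation_semigroup X) \<longleftrightarrow>
    (\<exists>B\<ge>0. \<forall>f\<in>funs X. \<forall>t\<ge>0. fnorm X (shift t f) \<le> B * fnorm X f)"
  by (simp add: uniformly_bounded_def translation_semigroup_def points_eq
      left_translation_cls pnorm_cls shift_mem) (simp add: Ball_def)

lemma uniformly_bounded_imp_uniformly_equicontinuous:
  assumes "uniformly_bounded X (translation_semigroup X)"
  shows "uniformly_equicontinuous X (translation_semigroup X)"
  unfolding uniformly_equicontinuous_def
proof (intro allI impI)
  fix e :: real assume e: "0 < e"
  obtain B where B: "0 \<le> B" "\<And>f t. f \<in> funs X \<Longrightarrow> 0 \<le> t \<Longrightarrow> fnorm X (shift t f) \<le> B * fnorm X f"
    using assms unfolding uniformly_bounded_iff by blast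
  define d where "d = e / (B + 1)"
  have d: "0 < d" "(B + 1) * d = e"
    using e B(1) by (simp_all add: d_def)
  have "pdist X (left_translation X t (cls X f)) (left_translation X t (cls X g)) < e"
    if "0 \<le> t" "f \<in> funs X" "g \<in> funs X" "pdist X (cls X f) (cls X g) < d" for t f g
  proof -
    have "fnorm X (shift t (\<lambda>x. f x - g x)) \<le> B * fnorm X (\<lambda>x. f x - g x)"
      using that by (intro B(2) diff_mem)
    also have "\<dots> \<le> B * d"
      using that B(1) by (intro mult_left_mono) (auto simp: pdist_cls)
    also have "\<dots> < e"
      using d by (simp add: algebra_simps)
    finally show ?thesis
      using that by (simp add: pdist_translation)
  qed
  then show "\<exists>\<delta>>0. \<forall>T\<in>translation_semigroup X. \<forall>f\<in>points X. \<forall>g\<in>points X.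
      pdist X f g < \<delta> \<longrightarrow> pdist X (T f) (T g) < e"
    using d(1) unfolding translation_semigroup_def points_eq 
    by (intro exI[of _ d]) simp
qed

end

section \<open>Infinite entropy from expanding translations\<close>

text \<open>The number \<open>n\<close> of points is quantified after the time \<open>t\<close>: this is what lets the cardinality of
separated sets grow faster than any exponential of the time.\<close>

locale expanding_translation_space = translation_space +
  assumes expanding: "\<And>D::real. 0 < D \<Longrightarrow> \<exists>t\<ge>D. \<forall>n::nat. \<exists>f. \<forall>i<n. f i \<in> funs X \<and> fnorm X (f i) \<le> 1 / D \<and>
      (\<forall>j<n. i \<noteq> j \<longrightarrow> 1 \<le> fnorm X (shift t (\<lambda>x. f i x - f j x)))"
begin

text \<open>The difference of two of the expanding functions is arbitrarily small but is moved to norm at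
least \<open>1\<close>, which violates equicontinuity at \<open>0\<close>.\<close>

lemma not_equicontinuous: "\<not> equicontinuous X (translation_semigroup X)"
proof
  assume "equicontinuous X (translation_semigroup X)"
  then obtain d where d: "0 < d" and eq: "\<And>t F. 0 \<le> t \<Longrightarrow> F \<in> points X \<Longrightarrow> pdist X (pzero X) F < d \<Longrightarrow>
      pdist X (left_translation X t (pzero X)) (left_translation X t F) < 1"
    unfolding equicontinuous_def translation_semigroup_def
    by (drule_tac spec[of _ 1]) (use pzero_in_points in auto)
  have "0 < 3 / d"
    using d by simp
  from expanding[OF this] obtain t where t: "3 / d \<le> t"
    and ex: "\<forall>n::nat. \<exists>f. \<forall>i<n. f i \<in> funs X \<and> fnorm X (f i) \<le> 1 / (3 / d) \<and>
      (\<forall>j<n. i \<noteq> j \<longrightarrow> 1 \<le> fnorm X (shift t (\<lambda>x. f i x - f j x)))"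
    by blast
  from ex[THEN spec, of 2] obtain f :: "nat \<Rightarrow> real \<Rightarrow> real" where
    f: "\<forall>i<2. f i \<in> funs X \<and> fnorm X (f i) \<le> 1 / (3 / d) \<and>
      (\<forall>j<2. i \<noteq> j \<longrightarrow> 1 \<le> fnorm X (shift t (\<lambda>x. f i x - f j x)))"
    by blast
  have t0: "0 \<le> t"
    using t d by (intro order_trans[OF _ t]) simp
  have f01: "f 0 \<in> funs X" "f 1 \<in> funs X" "fnorm X (f 0) \<le> d / 3" "fnorm X (f 1) \<le> d / 3"
    "1 \<le> fnorm X (shift t (\<lambda>x. f 1 x - f 0 x))"
    using f by auto
  let ?g = "\<lambda>x. f 0 x - f 1 x"
  have g: "?g \<in> funs X"
    by (intro diff_mem f01)
  have "fnorm X (\<lambda>x. 0 - ?g x) < d"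
    using fnorm_diff_le[OF f01(2,1)] f01(3,4) d by simp
  then have "pdist X (pzero X) (cls X ?g) < d"
    unfolding pzero_def by (subst pdist_cls[OF zero_mem g])
  then have "pdist X (left_translation X t (pzero X)) (left_translation X t (cls X ?g)) < 1"
    using eq[OF t0 cls_in_points[OF g]] by simp
  then show False
    using f01(5) pdist_translation[OF zero_mem g t0] unfolding pzero_def by simp
qed

text \<open>The witness is the compact set formed by \<open>0\<close> and finite sets \<open>A k\<close> of norm at most \<open>1 / (k + 1)\<close>, where
\<open>A k\<close> has at least \<open>exp ((t k)\<^sup>2)\<close> points and is separated at the time \<open>t k \<ge> k + 1\<close>. Along these times the
growth rate is at least \<open>t k\<close>, for every scale \<open>e \<le> 1\<close>.\<close>

lemma entropy_eq_infinity: "topological_entropy X = \<infinity>"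
proof -
  \<comment> \<open>more than exponentially many points, so that the growth rate is infinite\<close>
  define N :: "real \<Rightarrow> nat" where "N t = nat \<lceil>exp (t\<^sup>2)\<rceil>" for t
  define P where "P k t f \<longleftrightarrow> real k + 1 \<le> t \<and>
      (\<forall>i<N t. f i \<in> funs X \<and> fnorm X (f i) \<le> 1 / (real k + 1) \<and>
        (\<forall>j<N t. i \<noteq> j \<longrightarrow> 1 \<le> fnorm X (shift t (\<lambda>x. f i x - f j x))))"
    for k :: nat and t :: real and f :: "nat \<Rightarrow> real \<Rightarrow> real"
  have "\<exists>t f. P k t f" for k
  proof -
    have "0 < real k + 1"
      by simp
    from expanding[OF this] show ?thesis
      unfolding P_def by blast
  qed
  then obtain t f where P: "\<And>k. P k (t k) (f k)"
    by metis
  have t: "real k + 1 \<le> t k" for k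
    using P[of k] by (simp add: P_def)
  have f: "f k i \<in> funs X" "fnorm X (f k i) \<le> 1 / (real k + 1)" if "i < N (t k)" for k i
    using P[of k] that by (simp_all add: P_def)
  have t0: "0 \<le> t k" for k
    using t[of k] by linarith
  define A where "A k = (\<lambda>i. cls X (f k i)) ` {..<N (t k)}" for k
  define K where "K = insert (pzero X) (\<Union>k. A k)"
  have far: "1 \<le> pdist X (left_translation X (t k) (cls X (f k i))) (left_translation X (t k) (cls X (f k j)))"
    if "i < N (t k)" "j < N (t k)" "i \<noteq> j" for i j k
    using that P[of k] by (simp add: pdist_translation f t0 P_def)
  have cardA: "card (A k) = N (t k)" for k
  proof -
    have "inj_on (\<lambda>i. cls X (f k i)) {..<N (t k)}"
    proof (rule inj_onI, rule ccontr)
      fix i j assume ij: "i \<in> {..<N (t k)}" "j \<in> {..<N (t k)}" "cls X (f k i) = cls X (f k j)" "i \<noteq> j"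
      have "left_translation X (t k) (cls X (f k j)) \<in> points X"
        using ij by (simp add: left_translation_cls cls_in_points shift_mem f t0)
      then show False
        using far[of i k j] ij by simp
    qed
    then show ?thesis
      by (simp add: A_def card_image)
  qed
  have sepA: "separated X (t k) e (A k)" if "e \<le> 1" for k e
    unfolding separated_def
  proof (intro ballI impI)
    fix F G assume "F \<in> A k" "G \<in> A k" "F \<noteq> G"
    then obtain i j where "i < N (t k)" "j < N (t k)" "i \<noteq> j" "F = cls X (f k i)" "G = cls X (f k j)"
      by (auto simp: A_def)
    then have "e \<le> pdist X (left_translation X (t k) F) (left_translation X (t k) G)"
      using far[of i k j] that by simp
    then show "\<exists>u\<in>{0..t k}. e \<le> pdist X (left_translation X u F) (left_translation X u G)"
      using t0[of k] by (intro bexI[of _ "t k"]) auto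
  qed
  have comp: "compactin (norm_topology X) K"
    unfolding K_def norm_topology_eq
  proof (rule compactin_null_sequence_of_finite_sets[OF pzero_in_points])
    show "finite (A k)" for k
      by (simp add: A_def)
    show "A k \<subseteq> points X" for k
      by (auto simp: A_def cls_in_points f)
    fix e :: real assume "0 < e"
    have "(\<lambda>k. 1 / (real k + 1)) \<longlonglongrightarrow> 0"
      using LIMSEQ_inverse_real_of_nat by (simp add: inverse_eq_divide add.commute)
    then have "\<forall>\<^sub>F k in sequentially. 1 / (real k + 1) < e"
      using \<open>0 < e\<close> by (rule order_tendstoD)
    then show "\<forall>\<^sub>F k in sequentially. \<forall>F\<in>A k. pdist X (pzero X) F < e"
    proof eventually_elim
      case (elim k)
      have "pdist X (pzero X) (cls X (f k i)) \<le> 1 / (real k + 1)" if "i < N (t k)" for i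
        using f[OF that] fnorm_diff_commute[OF zero_mem, of "f k i"]
        by (simp add: pzero_def pdist_cls zero_mem)
      then show ?case
        using elim unfolding A_def by fastforce
    qed
  qed
  have "entropy_on X K = \<infinity>"
    unfolding entropy_on_def
  proof (rule Lim_at_right_0_eqI)
    fix e :: real assume e: "0 < e" "e < 1"
    have large: "ereal (t k) \<le> ereal (1 / t k) * log_enat (max_separated X (t k) e K)" for k
    proof -
      have pos: "0 < t k"
        using t[of k] by linarith
      have "enat (N (t k)) \<le> max_separated X (t k) e K"
        using max_separated_ge[of "A k" K X "t k" e] sepA[of e k] e cardA[of k]
        by (auto simp: K_def A_def)
      moreover have ge: "exp ((t k)\<^sup>2) \<le> real (N (t k))"
        by (simp add: N_def)
      ultimately have "ereal ((t k)\<^sup>2) \<le> log_enat (max_separated X (t k) e K)"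
      proof (cases "max_separated X (t k) e K")
        case (enat n)
        then have "exp ((t k)\<^sup>2) \<le> real n"
          using ge \<open>enat (N (t k)) \<le> _\<close> by simp
        moreover have "0 < real n"
          using calculation exp_gt_zero[of "(t k)\<^sup>2"] by linarith
        ultimately show ?thesis
          using enat by (auto simp: log_enat_def ln_ge_iff)
      qed (simp add: log_enat_def)
      then have "ereal (1 / t k) * ereal ((t k)\<^sup>2) \<le> ereal (1 / t k) * log_enat (max_separated X (t k) e K)"
        using pos by (intro ereal_mult_left_mono) auto
      then show ?thesis
        using pos by (simp add: power2_eq_square)
    qed
    have "\<infinity> \<le> Limsup at_top (\<lambda>t. ereal (1 / t) * log_enat (max_separated X t e K))"
      unfolding Limsup_def
    proof (rule INF_greatest)
      fix P :: "real \<Rightarrow> bool" assume "P \<in> {P. eventually P at_top}"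
      then obtain T where T: "\<And>s. T \<le> s \<Longrightarrow> P s"
        unfolding eventually_at_top_linorder by blast
      have "ereal b \<le> (SUP s\<in>{s. P s}. ereal (1 / s) * log_enat (max_separated X s e K))" for b
      proof -
        let ?k = "nat \<lceil>max T b\<rceil>"
        have k: "max T b \<le> t ?k"
          using t[of ?k] by linarith
        have "ereal b \<le> ereal (t ?k)"
          using k by simp
        also note large[of ?k]
        also have "ereal (1 / t ?k) * log_enat (max_separated X (t ?k) e K)
            \<le> (SUP s\<in>{s. P s}. ereal (1 / s) * log_enat (max_separated X s e K))"
          using T[of "t ?k"] k by (intro SUP_upper) auto
        finally show ?thesis .
      qed
      then have "(SUP s\<in>{s. P s}. ereal (1 / s) * log_enat (max_separated X s e K)) = \<infinity>"
        by (rule ereal_top)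
      then show "\<infinity> \<le> (SUP s\<in>{s. P s}. ereal (1 / s) * log_enat (max_separated X s e K))"
        by simp
    qed
    then show "Limsup at_top (\<lambda>t. ereal (1 / t) * log_enat (max_separated X t e K)) = \<infinity>"
      by simp
  qed
  then have "\<infinity> \<le> topological_entropy X"
    unfolding topological_entropy_def using comp by (intro SUP_upper2[of K]) auto
  then show ?thesis
    by simp
qed

end

section \<open>The equivalences for weighted spaces\<close>

locale weight =
  fixes v :: "real \<Rightarrow> real" and M w :: real
  assumes pos: "0 \<le> x \<Longrightarrow> 0 < v x"
    and M_ge: "1 \<le> M" and w_nonneg: "0 \<le> w"
    and growth: "0 \<le> x \<Longrightarrow> 0 \<le> t \<Longrightarrow> v x \<le> M * exp (w * t) * v (x + t)"
begin

lemma le_growth: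
  assumes "0 \<le> x" "x \<le> y" "y - x \<le> d"
  shows "v x \<le> M * exp (w * d) * v y"
proof -
  have "v x \<le> M * exp (w * (y - x)) * v y"
    using growth[of x "y - x"] assms by simp
  also have "\<dots> \<le> M * exp (w * d) * v y"
    using assms M_ge w_nonneg pos[of y]
    by (intro mult_right_mono mult_left_mono) (auto intro: mult_left_mono)
  finally show ?thesis .
qed

end

text \<open>What the two kinds of spaces have in common. The exponent \<open>q\<close> describes how the norm scales with the
weight. The assumption \<open>majorant\<close> stands in for completeness; there \<open>h\<close> is a representative of the
class of \<open>F k\<close>, because in \<open>L\<^sup>p\<close> the comparison with \<open>g\<close> holds only almost everywhere. In \<open>bumps\<close>,
the functions live on \<open>[y - 1, y]\<close> and are moved to \<open>[x, x + 1]\<close>, and each of these two intervals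
costs one factor \<open>M * exp w\<close>.\<close>

locale weighted_translation_space = translation_space X + weight v M w
  for X :: function_space and v M w +
  fixes q :: real
  assumes q_pos: "0 < q"
    and solid: "f \<in> funs X \<Longrightarrow> g \<in> funs X \<Longrightarrow> (\<And>x. 0 \<le> x \<Longrightarrow> \<bar>f x\<bar> \<le> \<bar>g x\<bar>) \<Longrightarrow> fnorm X f \<le> fnorm X g"
    and shift_le: "f \<in> funs X \<Longrightarrow> 0 \<le> t \<Longrightarrow> (\<And>x. 0 \<le> x \<Longrightarrow> v x \<le> R * v (x + t)) \<Longrightarrow>
           fnorm X (shift t f) \<le> R powr q * fnorm X f"
    and shift_tendsto: "f \<in> funs X \<Longrightarrow> (\<And>x y. 0 \<le> x \<Longrightarrow> x \<le> y \<Longrightarrow> v x \<le> R * v y) \<Longrightarrow>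
           ((\<lambda>t. fnorm X (shift t f)) \<longlongrightarrow> 0) at_top"
    and majorant: "(\<And>k. F k \<in> funs X) \<Longrightarrow> (\<And>k x. 0 \<le> F k x) \<Longrightarrow>
           (\<And>k. fnorm X (F k) \<le> (1 / 2) ^ k) \<Longrightarrow>
           \<exists>g\<in>funs X. \<forall>k::nat. \<exists>h\<in>funs X. ident X h (F k) \<and> (\<forall>x\<ge>0. \<bar>h x\<bar> \<le> \<bar>g x\<bar>)"
    and bumps: "0 \<le> x \<Longrightarrow> x + 1 \<le> y \<Longrightarrow>
           \<exists>f. \<forall>i<n::nat. f i \<in> funs X \<and> (\<forall>z. 0 \<le> f i z) \<and>
             fnorm X (f i) \<le> ((M * exp w)\<^sup>2 * v y / v x) powr q \<and>
             1 \<le> fnorm X (shift (y - 1 - x) (f i)) \<and>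
             (\<forall>j<n. i \<noteq> j \<longrightarrow> (\<forall>z. f i z = 0 \<or> f j z = 0))"
begin

text \<open>A ratio \<open>v x / v y\<close> above \<open>M * exp (w * (D + 1))\<close> is incompatible with \<open>y - x \<le> D + 1\<close>, so a large
ratio entails a late time; the other bound in \<open>L\<close> makes the bumps small.\<close>

lemma expanding_bumps:
  assumes unbdd: "\<And>R. \<exists>x y. 0 \<le> x \<and> x \<le> y \<and> R * v y < v x" and D: "0 < D"
  shows "\<exists>t\<ge>D. \<forall>n::nat. \<exists>f. \<forall>i<n. f i \<in> funs X \<and> (\<forall>z. 0 \<le> f i z) \<and> fnorm X (f i) \<le> 1 / D \<and>
      1 \<le> fnorm X (shift t (f i)) \<and> (\<forall>j<n. i \<noteq> j \<longrightarrow> (\<forall>z. f i z = 0 \<or> f j z = 0))"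
proof -
  define C where "C = (M * exp w)\<^sup>2"
  define L where "L = max (M * exp (w * (D + 1))) (C * D powr (1 / q))"
  have C: "0 < C"
    using M_ge by (simp add: C_def)
  obtain x y where xy: "0 \<le> x" "x \<le> y" "L * v y < v x"
    using unbdd by blast
  have v: "0 < v x" "0 < v y"
    using xy pos by auto
  have far: "D + 1 \<le> y - x"
  proof (rule ccontr)
    assume "\<not> D + 1 \<le> y - x"
    then have "v x \<le> M * exp (w * (D + 1)) * v y"
      using xy by (intro le_growth) auto
    also have "\<dots> \<le> L * v y"
      using v by (intro mult_right_mono) (auto simp: L_def)
    finally show False
      using xy by simp
  qed
  have "C * D powr (1 / q) * v y \<le> L * v y"
    using v by (intro mult_right_mono) (auto simp: L_def)
  then have "C * D powr (1 / q) * v y \<le> v x"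
    using xy by simp
  then have "C * v y / v x \<le> 1 / D powr (1 / q)"
    using v D by (simp add: field_simps)
  then have "(C * v y / v x) powr q \<le> (1 / D powr (1 / q)) powr q"
    using C v q_pos by (intro powr_mono2) auto
  also have "\<dots> = 1 / D"
    using D q_pos by (simp add: powr_divide powr_powr)
  finally have small: "(C * v y / v x) powr q \<le> 1 / D" .
  show ?thesis
  proof (intro exI[of _ "y - 1 - x"] conjI allI)
    show "D \<le> y - 1 - x"
      using far by simp
    have "x + 1 \<le> y"
      using far D by simp
    fix n :: nat
    show "\<exists>f. \<forall>i<n. f i \<in> funs X \<and> (\<forall>z. 0 \<le> f i z) \<and> fnorm X (f i) \<le> 1 / D \<and>
      1 \<le> fnorm X (shift (y - 1 - x) (f i)) \<and> (\<forall>j<n. i \<noteq> j \<longrightarrow> (\<forall>z. f i z = 0 \<or> f j z = 0))"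
      using bumps[OF xy(1) \<open>x + 1 \<le> y\<close>, of n] small unfolding C_def[symmetric]
      by (elim exE) (intro exI, auto intro: order_trans)
  qed
qed

text \<open>For functions with disjoint supports, \<open>\<bar>f i\<bar> \<le> \<bar>f i - f j\<bar>\<close>, so the distance of their translates is
at least the norm of one translate.\<close>

lemma expanding_translation_space:
  assumes unbdd: "\<And>R. \<exists>x y. 0 \<le> x \<and> x \<le> y \<and> R * v y < v x"
  shows "expanding_translation_space X"
proof
  fix D :: real assume D: "0 < D"
  obtain t where t: "D \<le> t" and ex: "\<forall>n::nat. \<exists>f. \<forall>i<n. f i \<in> funs X \<and> (\<forall>z. 0 \<le> f i z) \<and>
      fnorm X (f i) \<le> 1 / D \<and> 1 \<le> fnorm X (shift t (f i)) \<and>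
      (\<forall>j<n. i \<noteq> j \<longrightarrow> (\<forall>z. f i z = 0 \<or> f j z = 0))"
    using expanding_bumps[OF unbdd D] by blast
  show "\<exists>t\<ge>D. \<forall>n::nat. \<exists>f. \<forall>i<n. f i \<in> funs X \<and> fnorm X (f i) \<le> 1 / D \<and>
      (\<forall>j<n. i \<noteq> j \<longrightarrow> 1 \<le> fnorm X (shift t (\<lambda>x. f i x - f j x)))"
  proof (intro exI[of _ t] conjI allI t)
    fix n :: nat
    obtain f where f: "\<forall>i<n. f i \<in> funs X \<and> (\<forall>z. 0 \<le> f i z) \<and>
      fnorm X (f i) \<le> 1 / D \<and> 1 \<le> fnorm X (shift t (f i)) \<and>
      (\<forall>j<n. i \<noteq> j \<longrightarrow> (\<forall>z. f i z = 0 \<or> f j z = 0))"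
      using ex[THEN spec, of n] by blast
    have "1 \<le> fnorm X (shift t (\<lambda>x. f i x - f j x))" if "i < n" "j < n" "i \<noteq> j" for i j
    proof -
      have "0 \<le> t"
        using t D by simp
      have mem: "f i \<in> funs X" "f j \<in> funs X"
        using f that by auto
      have "1 \<le> fnorm X (shift t (f i))"
        using f that by blast
      also have "\<dots> \<le> fnorm X (shift t (\<lambda>x. f i x - f j x))"
      proof (rule solid)
        show "shift t (f i) \<in> funs X" "shift t (\<lambda>x. f i x - f j x) \<in> funs X"
          using shift_mem[OF mem(1) \<open>0 \<le> t\<close>] shift_mem[OF diff_mem[OF mem] \<open>0 \<le> t\<close>] .
        fix x :: real
        have "f i (x + t) = 0 \<or> f j (x + t) = 0"
          using f that by blast
        then show "\<bar>f i (x + t)\<bar> \<le> \<bar>f i (x + t) - f j (x + t)\<bar>"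
          by auto
      qed
      finally show ?thesis .
    qed
    then show "\<exists>f. \<forall>i<n. f i \<in> funs X \<and> fnorm X (f i) \<le> 1 / D \<and>
      (\<forall>j<n. i \<noteq> j \<longrightarrow> 1 \<le> fnorm X (shift t (\<lambda>x. f i x - f j x)))"
      using f by (intro exI[of _ f]) blast
  qed
qed

text \<open>This is the uniform boundedness principle made explicit: instead of a limit in a complete space, a
majorant of all bumps \<open>f k\<close> is used, whose translate at the time \<open>t k \<ge> 2 ^ k\<close> dominates that of \<open>f k\<close>.\<close>

lemma nonvanishing_orbit:
  assumes unbdd: "\<And>R. \<exists>x y. 0 \<le> x \<and> x \<le> y \<and> R * v y < v x"
  shows "\<exists>g\<in>funs X. \<not> ((\<lambda>t. fnorm X (shift t g)) \<longlongrightarrow> 0) at_top"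
proof -
  define P where "P k t f \<longleftrightarrow> 2 ^ k \<le> t \<and> f \<in> funs X \<and> (\<forall>z. 0 \<le> f z) \<and> fnorm X f \<le> (1 / 2) ^ k \<and>
      1 \<le> fnorm X (shift t f)" for k :: nat and t :: real and f :: "real \<Rightarrow> real"
  have "\<exists>t f. P k t f" for k
  proof -
    have "(0::real) < 2 ^ k"
      by simp
    from expanding_bumps[OF unbdd this] obtain t :: real where t: "2 ^ k \<le> t"
      and ex: "\<forall>n::nat. \<exists>f. \<forall>i<n. f i \<in> funs X \<and> (\<forall>z. 0 \<le> f i z) \<and>
        fnorm X (f i) \<le> 1 / 2 ^ k \<and> 1 \<le> fnorm X (shift t (f i)) \<and>
        (\<forall>j<n. i \<noteq> j \<longrightarrow> (\<forall>z. f i z = 0 \<or> f j z = 0))"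
      by blast
    from ex[THEN spec, of 1] obtain f :: "nat \<Rightarrow> real \<Rightarrow> real" where
      "f 0 \<in> funs X \<and> (\<forall>z. 0 \<le> f 0 z) \<and> fnorm X (f 0) \<le> 1 / 2 ^ k \<and> 1 \<le> fnorm X (shift t (f 0))"
      by auto
    then have "P k t (f 0)"
      using t by (simp add: P_def power_one_over)
    then show ?thesis
      by blast
  qed
  then obtain t f where P: "\<And>k. P k (t k) (f k)"
    by metis
  have f: "f k \<in> funs X" "0 \<le> f k z" "fnorm X (f k) \<le> (1 / 2) ^ k" "1 \<le> fnorm X (shift (t k) (f k))"
    and t: "2 ^ k \<le> t k" for k z
    using P[of k] by (simp_all add: P_def)
  obtain g where g: "g \<in> funs X"
    "\<And>k. \<exists>h\<in>funs X. ident X h (f k) \<and> (\<forall>x\<ge>0. \<bar>h x\<bar> \<le> \<bar>g x\<bar>)"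
    using majorant[of f] f by blast
  have big: "1 \<le> fnorm X (shift (t k) g)" for k
  proof -
    have t0: "0 \<le> t k"
      by (rule order_trans[OF _ t]) simp
    obtain h where h: "h \<in> funs X" "ident X h (f k)" "\<And>x. 0 \<le> x \<Longrightarrow> \<bar>h x\<bar> \<le> \<bar>g x\<bar>"
      using g(2) by blast
    have "fnorm X (shift (t k) h) = fnorm X (shift (t k) (f k))"
      using fnorm_shift_eq_0[OF diff_mem[OF h(1) f(1)] _ t0] h(2) ident_iff[OF h(1) f(1)]
      by (intro fnorm_cong shift_mem h f t0) simp
    moreover have "fnorm X (shift (t k) h) \<le> fnorm X (shift (t k) g)"
      using t0 by (intro solid shift_mem h g) auto
    ultimately show ?thesis
      using f(4)[of k] by simp
  qed
  have "\<not> ((\<lambda>t. fnorm X (shift t g)) \<longlongrightarrow> 0) at_top"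
  proof
    assume "((\<lambda>t. fnorm X (shift t g)) \<longlongrightarrow> 0) at_top"
    then have "\<forall>\<^sub>F t in at_top. fnorm X (shift t g) < 1"
      by (rule order_tendstoD) simp
    then obtain T where T: "\<And>t. T \<le> t \<Longrightarrow> fnorm X (shift t g) < 1"
      unfolding eventually_at_top_linorder by blast
    obtain k where "T < 2 ^ k"
      using real_arch_pow[of 2 T] by auto
    then show False
      using T[of "t k"] t[of k] big[of k] by simp
  qed
  then show ?thesis
    using g(1) by blast
qed

theorem all_equivalent_translations:
  "all_equivalent
    [(SUP (x, y)\<in>{(x, y). 0 \<le> x \<and> x \<le> y}. ereal (v x / v y)) = \<infinity>,
     \<exists>f\<in>points X. \<not> limitin (norm_topology X) (\<lambda>t. left_translation X t f) (pzero X) at_top,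
     \<not> uniformly_bounded X (translation_semigroup X),
     \<not> uniformly_equicontinuous X (translation_semigroup X),
     \<not> equicontinuous X (translation_semigroup X),
     topological_entropy X \<noteq> 0,
     topological_entropy X = \<infinity>]"
proof (cases "\<exists>R. \<forall>x y. 0 \<le> x \<longrightarrow> x \<le> y \<longrightarrow> v x \<le> R * v y")
  case True
  then obtain R where R: "\<And>x y. 0 \<le> x \<Longrightarrow> x \<le> y \<Longrightarrow> v x \<le> R * v y"
    by blast
  have "(SUP (x, y)\<in>{(x, y). 0 \<le> x \<and> x \<le> y}. ereal (v x / v y)) \<le> ereal R"
  proof (rule SUP_least, clarify)
    fix x y :: real assume "0 \<le> x" "x \<le> y"
    then show "ereal (v x / v y) \<le> ereal R"
      using R[of x y] pos[of y] by (simp add: pos_divide_le_eq)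
  qed
  then have 1: "(SUP (x, y)\<in>{(x, y). 0 \<le> x \<and> x \<le> y}. ereal (v x / v y)) \<noteq> \<infinity>"
    by auto
  have 2: "\<forall>f\<in>points X. limitin (norm_topology X) (\<lambda>t. left_translation X t f) (pzero X) at_top"
    using shift_tendsto R by (auto simp: points_eq limitin_zero_iff)
  have B: "fnorm X (shift t f) \<le> R powr q * fnorm X f" if "f \<in> funs X" "0 \<le> t" for t f
    using that R by (intro shift_le) auto
  then have 3: "uniformly_bounded X (translation_semigroup X)"
    unfolding uniformly_bounded_iff by (intro exI[of _ "R powr q"]) auto
  note 4 = uniformly_bounded_imp_uniformly_equicontinuous[OF 3]
  have 5: "equicontinuous X (translation_semigroup X)"
    using 4 not_uniformly_equicontinuous by blast
  have 6: "topological_entropy X = 0"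
    using B by (rule entropy_eq_0)
  show ?thesis
    using 1 2 3 4 5 6 by (simp add: all_equivalent_def)
next
  case False
  then have unbdd: "\<exists>x y. 0 \<le> x \<and> x \<le> y \<and> R * v y < v x" for R
    by (meson not_le)
  interpret expanding_translation_space X
    by (rule expanding_translation_space[OF unbdd])
  have 1: "(SUP (x, y)\<in>{(x, y). 0 \<le> x \<and> x \<le> y}. ereal (v x / v y)) = \<infinity>"
  proof (rule ereal_top)
    fix R
    obtain x y where xy: "0 \<le> x" "x \<le> y" "R * v y < v x"
      using unbdd by blast
    then have "ereal R \<le> ereal (v x / v y)"
      using pos[of y] by (simp add: pos_le_divide_eq)
    also have "\<dots> \<le> (SUP (x, y)\<in>{(x, y). 0 \<le> x \<and> x \<le> y}. ereal (v x / v y))"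
      using xy by (intro SUP_upper2[of "(x, y)"]) auto
    finally show "ereal R \<le> (SUP (x, y)\<in>{(x, y). 0 \<le> x \<and> x \<le> y}. ereal (v x / v y))" .
  qed
  have 2: "\<exists>f\<in>points X. \<not> limitin (norm_topology X) (\<lambda>t. left_translation X t f) (pzero X) at_top"
    using nonvanishing_orbit[OF unbdd] limitin_zero_iff cls_in_points by blast
  note 5 = not_equicontinuous
  note 4 = not_uniformly_equicontinuous[OF 5]
  have 3: "\<not> uniformly_bounded X (translation_semigroup X)"
    using 4 uniformly_bounded_imp_uniformly_equicontinuous by blast
  show ?thesis
    using 1 2 3 4 5 entropy_eq_infinity by (simp add: all_equivalent_def)
qed

end

section \<open>Weighted continuous functions vanishing at infinity\<close>

locale C0_weight = weight
begin

abbreviation C0 :: function_space where "C0 \<equiv> C0_space v"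

lemma C0_mem: "f \<in> funs C0 \<longleftrightarrow> continuous_on {0..} f \<and> ((\<lambda>x. \<bar>f x\<bar> * v x) \<longlongrightarrow> 0) at_top"
  by (simp add: C0_space_def)

text \<open>On a compact interval \<open>{0..N}\<close>, the growth condition bounds the weight by a multiple of \<open>v N\<close>, although
\<open>v\<close> need not be continuous.\<close>

lemma C0_bdd:
  assumes "f \<in> funs C0"
  shows "bdd_above ((\<lambda>x. \<bar>f x\<bar> * v x) ` {0..})"
proof -
  have cont: "continuous_on {0..} f" and lim: "((\<lambda>x. \<bar>f x\<bar> * v x) \<longlongrightarrow> 0) at_top"
    using assms by (auto simp: C0_mem)
  obtain N where N: "\<And>x. N \<le> x \<Longrightarrow> \<bar>f x\<bar> * v x < 1"
    using order_tendstoD(2)[OF lim, of 1] unfolding eventually_at_top_linorder by auto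
  define N' where "N' = max 0 N"
  have "compact (f ` {0..N'})"
    using continuous_on_subset[OF cont] by (intro compact_continuous_image) auto
  then obtain b where "\<forall>y\<in>f ` {0..N'}. norm y \<le> b"
    using compact_imp_bounded[of "f ` {0..N'}"] unfolding bounded_iff by blast
  then have b: "\<bar>f x\<bar> \<le> b" if "x \<in> {0..N'}" for x
    using that by simp
  show ?thesis
  proof (rule bdd_aboveI2)
    fix x :: real assume x: "x \<in> {0..}"
    show "\<bar>f x\<bar> * v x \<le> max 1 (b * (M * exp (w * N') * v N'))"
    proof (cases "x \<le> N'")
      case True
      have "\<bar>f x\<bar> * v x \<le> b * (M * exp (w * N') * v N')"
        using b[of x] True x pos[of x] by (intro mult_mono le_growth) auto
      then show ?thesis
        by simp
    next
      case False
      then have "\<bar>f x\<bar> * v x < 1"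
        using N[of x] by (simp add: N'_def)
      then show ?thesis
        by simp
    qed
  qed
qed

lemma C0_upper: "f \<in> funs C0 \<Longrightarrow> 0 \<le> x \<Longrightarrow> \<bar>f x\<bar> * v x \<le> fnorm C0 f"
  using cSUP_upper[OF _ C0_bdd, of x f] by (simp add: C0_space_def)

lemma C0_least: "(\<And>x. 0 \<le> x \<Longrightarrow> \<bar>f x\<bar> * v x \<le> b) \<Longrightarrow> fnorm C0 f \<le> b"
  unfolding C0_space_def by (auto intro: cSUP_least)

lemma C0_nonneg: "f \<in> funs C0 \<Longrightarrow> 0 \<le> fnorm C0 f"
  using pos[of 0] by (intro order_trans[OF _ C0_upper[of f 0]]) auto

lemma C0_diff: "f \<in> funs C0 \<Longrightarrow> g \<in> funs C0 \<Longrightarrow> (\<lambda>x. f x - g x) \<in> funs C0"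
proof -
  assume fg: "f \<in> funs C0" "g \<in> funs C0"
  have "((\<lambda>x. \<bar>f x\<bar> * v x + \<bar>g x\<bar> * v x) \<longlongrightarrow> 0 + 0) at_top"
    using fg by (intro tendsto_add) (auto simp: C0_mem)
  then have "((\<lambda>x. \<bar>f x\<bar> * v x + \<bar>g x\<bar> * v x) \<longlongrightarrow> 0) at_top"
    by simp
  then have "((\<lambda>x. \<bar>f x - g x\<bar> * v x) \<longlongrightarrow> 0) at_top"
  proof (rule Lim_null_comparison[rotated])
    show "\<forall>\<^sub>F x in at_top. norm (\<bar>f x - g x\<bar> * v x) \<le> \<bar>f x\<bar> * v x + \<bar>g x\<bar> * v x"
      using eventually_ge_at_top[of 0]
    proof eventually_elim
      case (elim x)
      have "\<bar>f x - g x\<bar> * v x \<le> (\<bar>f x\<bar> + \<bar>g x\<bar>) * v x"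
        using pos[OF elim] by (intro mult_right_mono) auto
      then show ?case
        using pos[OF elim] by (simp add: abs_mult algebra_simps)
    qed
  qed
  then show ?thesis
    using fg by (auto simp: C0_mem intro: continuous_on_diff)
qed

lemma C0_shift:
  assumes f: "f \<in> funs C0" and t: "0 \<le> t"
  shows "shift t f \<in> funs C0"
  unfolding C0_mem
proof
  have cont: "continuous_on {0..} f" and lim: "((\<lambda>x. \<bar>f x\<bar> * v x) \<longlongrightarrow> 0) at_top"
    using assms by (auto simp: C0_mem)
  show "continuous_on {0..} (shift t f)"
    using t by (intro continuous_on_compose2[OF cont] continuous_intros) auto
  have "filterlim (\<lambda>x. x + t) at_top at_top"
    using filterlim_tendsto_add_at_top[OF tendsto_const[of t] filterlim_ident]
    by (simp add: add.commute)
  then have "((\<lambda>x. \<bar>f (x + t)\<bar> * v (x + t)) \<longlongrightarrow> 0) at_top"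
    by (rule filterlim_compose[OF lim])
  then have "((\<lambda>x. (M * exp (w * t)) * (\<bar>f (x + t)\<bar> * v (x + t))) \<longlongrightarrow> 0) at_top"
    by (rule tendsto_mult_right_zero)
  then show "((\<lambda>x. \<bar>f (x + t)\<bar> * v x) \<longlongrightarrow> 0) at_top"
  proof (rule Lim_null_comparison[rotated])
    show "\<forall>\<^sub>F x in at_top. norm (\<bar>f (x + t)\<bar> * v x) \<le> (M * exp (w * t)) * (\<bar>f (x + t)\<bar> * v (x + t))"
      using eventually_ge_at_top[of 0]
    proof eventually_elim
      case (elim x)
      have "\<bar>f (x + t)\<bar> * v x \<le> \<bar>f (x + t)\<bar> * (M * exp (w * t) * v (x + t))"
        using growth[OF elim t] by (rule mult_left_mono) simp
      then show ?case
        using pos[OF elim] by (simp add: abs_mult mult_ac)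
    qed
  qed
qed

lemma C0_shift_le:
  assumes f: "f \<in> funs C0" and t: "0 \<le> t" and R: "\<And>x. 0 \<le> x \<Longrightarrow> v x \<le> R * v (x + t)"
  shows "fnorm C0 (shift t f) \<le> R * fnorm C0 f"
proof (rule C0_least)
  fix x :: real assume x: "0 \<le> x"
  have "0 < R * v (0 + t)"
    using R[of 0] pos[of 0] by simp
  then have R0: "0 \<le> R"
    using pos[of t] t by (simp add: zero_less_mult_iff)
  have "\<bar>f (x + t)\<bar> * v x \<le> \<bar>f (x + t)\<bar> * (R * v (x + t))"
    using R[OF x] by (rule mult_left_mono) simp
  also have "\<dots> = R * (\<bar>f (x + t)\<bar> * v (x + t))"
    by simp
  also have "\<dots> \<le> R * fnorm C0 f"
    using C0_upper[OF f, of "x + t"] x t R0 by (intro mult_left_mono) auto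
  finally show "\<bar>f (x + t)\<bar> * v x \<le> R * fnorm C0 f" .
qed

lemma C0_shift_tendsto:
  assumes f: "f \<in> funs C0" and R: "\<And>x y. 0 \<le> x \<Longrightarrow> x \<le> y \<Longrightarrow> v x \<le> R * v y"
  shows "((\<lambda>t. fnorm C0 (shift t f)) \<longlongrightarrow> 0) at_top"
proof (rule order_tendstoI)
  fix a :: real assume a: "a < 0"
  show "\<forall>\<^sub>F t in at_top. a < fnorm C0 (shift t f)"
    using eventually_ge_at_top[of 0]
  proof eventually_elim
    case (elim t)
    then show ?case
      using a C0_nonneg[OF C0_shift[OF f elim]] by simp
  qed
next
  fix e :: real assume e: "0 < e"
  have lim: "((\<lambda>x. \<bar>f x\<bar> * v x) \<longlongrightarrow> 0) at_top"
    using f by (auto simp: C0_mem)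
  have R1: "1 \<le> R"
    using R[of 0 0] pos[of 0] by simp
  then have "0 < e / (2 * R)"
    using e by simp
  then obtain N where N: "\<And>x. N \<le> x \<Longrightarrow> \<bar>f x\<bar> * v x < e / (2 * R)"
    using order_tendstoD(2)[OF lim] unfolding eventually_at_top_linorder by blast
  show "\<forall>\<^sub>F t in at_top. fnorm C0 (shift t f) < e"
    using eventually_ge_at_top[of "max 0 N"]
  proof eventually_elim
    case (elim t)
    have "fnorm C0 (shift t f) \<le> e / 2"
    proof (rule C0_least)
      fix x :: real assume x: "0 \<le> x"
      have "\<bar>f (x + t)\<bar> * v x \<le> \<bar>f (x + t)\<bar> * (R * v (x + t))"
        using R[of x "x + t"] x elim by (intro mult_left_mono) auto
      also have "\<dots> = R * (\<bar>f (x + t)\<bar> * v (x + t))"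
        by simp
      also have "\<dots> \<le> R * (e / (2 * R))"
        using N[of "x + t"] x elim R1 by (intro mult_left_mono) auto
      also have "\<dots> = e / 2"
        using R1 by simp
      finally show "\<bar>f (x + t)\<bar> * v x \<le> e / 2" .
    qed
    then show ?case
      using e by simp
  qed
qed

text \<open>The sum of all functions works. On bounded intervals \<open>v\<close> is bounded away from \<open>0\<close>, so the series
converges uniformly there and its sum is continuous; multiplied by \<open>v\<close> it converges uniformly on the
whole half line, which gives the decay at infinity.\<close>

lemma C0_majorant:
  assumes F: "\<And>k. F k \<in> funs C0" "\<And>k x. 0 \<le> F k x" "\<And>k. fnorm C0 (F k) \<le> (1 / 2) ^ k"
  shows "\<exists>g\<in>funs C0. \<forall>k::nat. \<exists>h\<in>funs C0. ident C0 h (F k) \<and> (\<forall>x\<ge>0. \<bar>h x\<bar> \<le> \<bar>g x\<bar>)"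
proof -
  define g where "g x = (\<Sum>k. F k x)" for x
  have Fv: "F k x * v x \<le> (1 / 2) ^ k" if "0 \<le> x" for k x
    using C0_upper[OF F(1) that, of k] F(2)[of k x] F(3)[of k] by simp
  have geo: "summable (\<lambda>k. (1 / 2 :: real) ^ k)"
    by (rule summable_geometric) simp
  have Fb: "F k x \<le> (M * exp (w * N) / v 0) * (1 / 2) ^ k" if "0 \<le> x" "x \<le> N" for k x N
  proof -
    have "F k x * v 0 \<le> F k x * (M * exp (w * N) * v x)"
      using le_growth[of 0 x N] that F(2) by (intro mult_left_mono) auto
    also have "\<dots> = M * exp (w * N) * (F k x * v x)"
      by simp
    also have "\<dots> \<le> M * exp (w * N) * (1 / 2) ^ k"
      using Fv[OF that(1)] M_ge by (intro mult_left_mono) auto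
    finally show ?thesis
      using pos[of 0] by (simp add: field_simps)
  qed
  have sum: "summable (\<lambda>k. F k x)" if "0 \<le> x" for x
    using F(2) Fb[OF that order_refl]
    by (intro summable_comparison_test[OF _ summable_mult[OF geo, of "M * exp (w * x) / v 0"]]) auto
  have cont: "continuous_on {0..N} g" for N
  proof (rule uniform_limit_theorem)
    show "uniform_limit {0..N} (\<lambda>n x. \<Sum>k<n. F k x) g sequentially"
      unfolding g_def
      by (rule Weierstrass_m_test[OF _ summable_mult[OF geo, of "M * exp (w * N) / v 0"]])
        (use F(2) Fb in auto)
    show "\<forall>\<^sub>F n in sequentially. continuous_on {0..N} (\<lambda>x. \<Sum>k<n. F k x)"
      using F(1) by (intro always_eventually allI continuous_on_sum)
        (auto simp: C0_mem intro: continuous_on_subset[of "{0..}"])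
  qed simp
  have "continuous_on {0..} g"
    unfolding continuous_on_eq_continuous_within
  proof
    fix x :: real assume x: "x \<in> {0..}"
    have "at x within {0..} = at x within {0..x + 1}"
      by (rule at_within_nhd[of x "{..<x + 1}"]) auto
    then show "continuous (at x within {0..}) g"
      using cont[of "x + 1"] x by (simp add: continuous_on_eq_continuous_within)
  qed
  moreover have "((\<lambda>x. \<bar>g x\<bar> * v x) \<longlongrightarrow> 0) at_top"
  proof (rule tendstoI)
    fix e :: real assume e: "0 < e"
    have "uniform_limit {0..} (\<lambda>n x. \<Sum>k<n. F k x * v x) (\<lambda>x. \<Sum>k. F k x * v x) sequentially"
    proof (rule Weierstrass_m_test[OF _ geo])
      fix k and x :: real assume "x \<in> {0..}"
      then show "norm (F k x * v x) \<le> (1 / 2) ^ k"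
        using Fv[of x k] F(2)[of k x] pos[of x] by (simp add: abs_mult)
    qed
    then have "\<forall>\<^sub>F n in sequentially. \<forall>x\<in>{0..}. dist (\<Sum>k<n. F k x * v x) (\<Sum>k. F k x * v x) < e / 2"
      by (rule uniform_limitD) (use e in simp)
    then obtain n where "\<forall>x\<in>{0..}. dist (\<Sum>k<n. F k x * v x) (\<Sum>k. F k x * v x) < e / 2"
      unfolding eventually_sequentially by blast
    then have n: "\<bar>(\<Sum>k<n. F k x * v x) - g x * v x\<bar> < e / 2" if "0 \<le> x" for x
      using that suminf_mult2[OF sum[OF that], of "v x"] by (simp add: g_def dist_real_def)
    have "((\<lambda>x. \<Sum>k<n. F k x * v x) \<longlongrightarrow> 0) at_top"
      using F(1,2) by (intro tendsto_null_sum) (simp add: C0_mem)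
    then have "\<forall>\<^sub>F x in at_top. dist (\<Sum>k<n. F k x * v x) 0 < e / 2"
      using e by (intro tendstoD) auto
    then show "\<forall>\<^sub>F x in at_top. dist (\<bar>g x\<bar> * v x) 0 < e"
      using eventually_ge_at_top[of 0]
    proof eventually_elim
      case (elim x)
      have "\<bar>g x\<bar> * v x = \<bar>g x * v x\<bar>"
        using pos[of x] elim by (simp add: abs_mult)
      moreover have "\<bar>\<Sum>k<n. F k x * v x\<bar> < e / 2"
        using elim by simp
      ultimately have "\<bar>g x\<bar> * v x < e"
        using n[OF elim(2)] by linarith
      then show ?case
        using pos[OF elim(2)] by (simp add: abs_mult)
    qed
  qed
  ultimately have g: "g \<in> funs C0"
    by (simp add: C0_mem)
  have le: "\<bar>F k x\<bar> \<le> \<bar>g x\<bar>" if "0 \<le> x" for k x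
  proof -
    have "F k x = (\<Sum>i\<in>{k}. F i x)"
      by simp
    also have "\<dots> \<le> g x"
      unfolding g_def using F(2) by (intro sum_le_suminf sum that) auto
    finally show ?thesis
      using F(2)[of k x] by simp
  qed
  have "ident C0 (F k) (F k)" for k
    by (simp add: C0_space_def)
  then show ?thesis
    using g F(1) le by blast
qed

text \<open>The bumps are tents of width \<open>1 / n\<close> centred at \<open>y - 1 + s i\<close>. The height \<open>K / v x\<close> makes the peak of the
translated tent, at \<open>x + s i\<close>, have weighted height at least \<open>1\<close>.\<close>

lemma C0_bumps:
  assumes x: "0 \<le> x" and xy: "x + 1 \<le> y"
  shows "\<exists>f. \<forall>i<n::nat. f i \<in> funs C0 \<and> (\<forall>z. 0 \<le> f i z) \<and>
             fnorm C0 (f i) \<le> ((M * exp w)\<^sup>2 * v y / v x) \<and>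
             1 \<le> fnorm C0 (shift (y - 1 - x) (f i)) \<and>
             (\<forall>j<n. i \<noteq> j \<longrightarrow> (\<forall>z. f i z = 0 \<or> f j z = 0))"
proof -
  define K where "K = M * exp w"
  define s where "s i = (real i + 1 / 2) / real n" for i :: nat
  define f where "f i z = K / v x * max 0 (1 - 2 * real n * \<bar>z - (y - 1 + s i)\<bar>)" for i z
  have K: "0 < K"
    using M_ge by (simp add: K_def)
  have vx: "0 < v x"
    using pos x by simp
  have zero: "f i z = 0" if "1 \<le> 2 * real n * \<bar>z - (y - 1 + s i)\<bar>" for i z
    using that by (simp add: f_def)
  have props: "f i \<in> funs C0 \<and> (\<forall>z. 0 \<le> f i z) \<and>
             fnorm C0 (f i) \<le> (K\<^sup>2 * v y / v x) \<and>
             1 \<le> fnorm C0 (shift (y - 1 - x) (f i)) \<and>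
             (\<forall>j<n. i \<noteq> j \<longrightarrow> (\<forall>z. f i z = 0 \<or> f j z = 0))" if i: "i < n" for i
  proof (intro conjI allI impI)
    have n: "0 < real n"
      using i by simp
    have "real i + 1 / 2 \<le> real n - 1 / 2"
      using i by linarith
    then have "s i \<le> (real n - 1 / 2) / real n"
      unfolding s_def using n by (intro divide_right_mono) auto
    also have "\<dots> = 1 - 1 / (2 * real n)"
      using n by (simp add: field_simps)
    finally have s: "1 / (2 * real n) \<le> s i" "s i \<le> 1 - 1 / (2 * real n)"
      using n by (auto simp: s_def field_simps)
    have out: "f i z = 0" if "z \<le> y - 1 \<or> y \<le> z" for z
    proof -
      have "1 / (2 * real n) \<le> \<bar>z - (y - 1 + s i)\<bar>"
        using that s by linarith
      then show ?thesis
        using n by (intro zero) (simp add: field_simps)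
    qed
    show f0: "0 \<le> f i z" for z
      using K vx by (simp add: f_def)
    show mem: "f i \<in> funs C0"
      unfolding C0_mem
    proof
      show "continuous_on {0..} (f i)"
        unfolding f_def by (intro continuous_intros)
      have "\<forall>\<^sub>F z in at_top. 0 = \<bar>f i z\<bar> * v z"
        using eventually_ge_at_top[of y] by eventually_elim (simp add: out)
      then show "((\<lambda>z. \<bar>f i z\<bar> * v z) \<longlongrightarrow> 0) at_top"
        by (rule Lim_transform_eventually[OF tendsto_const])
    qed
    show "fnorm C0 (f i) \<le> K\<^sup>2 * v y / v x"
    proof (rule C0_least)
      fix z :: real assume z: "0 \<le> z"
      show "\<bar>f i z\<bar> * v z \<le> K\<^sup>2 * v y / v x"
      proof (cases "z \<le> y - 1 \<or> y \<le> z")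
        case True
        then show ?thesis
          using out[OF True] vx pos[of y] x xy by simp
      next
        case False
        have "f i z \<le> K / v x * 1"
          unfolding f_def using K vx by (intro mult_left_mono) auto
        moreover have "v z \<le> K * v y"
          using le_growth[of z y 1] z False by (simp add: K_def)
        ultimately have "f i z * v z \<le> (K / v x * 1) * (K * v y)"
          using f0 pos[OF z] K vx by (intro mult_mono) auto
        then show ?thesis
          using f0 by (simp add: power2_eq_square)
      qed
    qed
    have s0: "0 \<le> s i"
      using s(1) n by (intro order_trans[OF _ s(1)]) simp
    have s1: "s i \<le> 1"
      using n by (intro order_trans[OF s(2)]) simp
    have "v x \<le> K * v (x + s i)"
      using le_growth[of x "x + s i" 1] x s0 s1 by (simp add: K_def)
    then have "1 \<le> K / v x * v (x + s i)"
      using vx by (simp add: field_simps)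
    also have "\<dots> = \<bar>f i (x + s i + (y - 1 - x))\<bar> * v (x + s i)"
      using K vx by (simp add: f_def)
    also have "\<dots> \<le> fnorm C0 (shift (y - 1 - x) (f i))"
      using x xy s0 by (intro C0_upper C0_shift mem) auto
    finally show "1 \<le> fnorm C0 (shift (y - 1 - x) (f i))" .
    fix j z assume j: "j < n" "i \<noteq> j"
    have "1 \<le> \<bar>real i - real j\<bar>"
      using j(2) by linarith
    also have "\<dots> = real n * \<bar>s i - s j\<bar>"
    proof -
      have "real n * (s i - s j) = real i - real j"
        using n by (simp add: s_def field_simps)
      then have "\<bar>real i - real j\<bar> = \<bar>real n * (s i - s j)\<bar>"
        by simp
      then show ?thesis
        by (simp add: abs_mult)
    qed
    also have "\<dots> \<le> real n * (\<bar>z - (y - 1 + s i)\<bar> + \<bar>z - (y - 1 + s j)\<bar>)"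
      using n by (intro mult_left_mono) auto
    finally have "1 \<le> 2 * real n * \<bar>z - (y - 1 + s i)\<bar> \<or> 1 \<le> 2 * real n * \<bar>z - (y - 1 + s j)\<bar>"
      by (simp add: algebra_simps) linarith
    then show "f i z = 0 \<or> f j z = 0"
      using zero by blast
  qed
  show ?thesis
    using props unfolding K_def by blast
qed

sublocale C0: weighted_translation_space "C0_space v" v M w 1
proof
  show "(\<lambda>x. 0) \<in> funs C0"
    by (simp add: C0_mem)
  show zero: "fnorm C0 (\<lambda>x. 0) = 0"
    by (simp add: C0_space_def)
  fix f g t
  assume f: "f \<in> funs C0"
  show "0 \<le> fnorm C0 f"
    by (rule C0_nonneg[OF f])
  show "0 \<le> t \<Longrightarrow> shift t f \<in> funs C0"
    by (rule C0_shift[OF f])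
  show "((\<lambda>t. fnorm C0 (shift t f)) \<longlongrightarrow> 0) at_top"
    if "\<And>x y. 0 \<le> x \<Longrightarrow> x \<le> y \<Longrightarrow> v x \<le> R * v y" for R
    using that by (rule C0_shift_tendsto[OF f])
  show "fnorm C0 (shift t f) \<le> R powr 1 * fnorm C0 f"
    if "0 \<le> t" "\<And>x. 0 \<le> x \<Longrightarrow> v x \<le> R * v (x + t)" for R
  proof -
    have "fnorm C0 (shift t f) \<le> R * fnorm C0 f"
      using that by (rule C0_shift_le[OF f])
    also have "\<dots> \<le> \<bar>R\<bar> * fnorm C0 f"
      using C0_nonneg[OF f] by (intro mult_right_mono) auto
    finally show ?thesis
      using that(2)[of 0] pos[of 0] pos[of t] that(1) by (simp add: powr_one_gt_zero_iff)
  qed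
  assume g: "g \<in> funs C0"
  show "(\<lambda>x. f x - g x) \<in> funs C0"
    by (rule C0_diff[OF f g])
  show "fnorm C0 (\<lambda>x. f x - g x) \<le> fnorm C0 f + fnorm C0 g"
  proof (rule C0_least)
    fix x :: real assume x: "0 \<le> x"
    have "\<bar>f x - g x\<bar> * v x \<le> (\<bar>f x\<bar> + \<bar>g x\<bar>) * v x"
      using pos[OF x] by (intro mult_right_mono) auto
    then show "\<bar>f x - g x\<bar> * v x \<le> fnorm C0 f + fnorm C0 g"
      using C0_upper[OF f x] C0_upper[OF g x] by (simp add: algebra_simps)
  qed
  show "ident C0 f g \<longleftrightarrow> fnorm C0 (\<lambda>x. f x - g x) = 0"
  proof
    assume "ident C0 f g"
    then show "fnorm C0 (\<lambda>x. f x - g x) = 0"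
      by (simp add: C0_space_def)
  next
    assume 0: "fnorm C0 (\<lambda>x. f x - g x) = 0"
    have "f x = g x" if x: "0 \<le> x" for x
    proof -
      have "\<bar>f x - g x\<bar> * v x \<le> 0"
        using C0_upper[OF C0_diff[OF f g] x] 0 by simp
      then show ?thesis
        using pos[OF x] by (simp add: mult_le_0_iff)
    qed
    then show "ident C0 f g"
      by (simp add: C0_space_def)
  qed
  show "fnorm C0 f \<le> fnorm C0 g" if "\<And>x. 0 \<le> x \<Longrightarrow> \<bar>f x\<bar> \<le> \<bar>g x\<bar>"
  proof (rule C0_least)
    fix x :: real assume x: "0 \<le> x"
    have "\<bar>f x\<bar> * v x \<le> \<bar>g x\<bar> * v x"
      using that[OF x] pos[OF x] by (intro mult_right_mono) auto
    then show "\<bar>f x\<bar> * v x \<le> fnorm C0 g"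
      using C0_upper[OF g x] by simp
  qed
next
  fix t :: real assume t: "0 \<le> t"
  show "\<exists>c. \<forall>f\<in>funs C0. fnorm C0 (shift t f) \<le> c * fnorm C0 f"
    using growth t by (intro exI[of _ "M * exp (w * t)"] ballI C0_shift_le) auto
next
  fix F :: "nat \<Rightarrow> real \<Rightarrow> real"
  assume "\<And>k. F k \<in> funs C0" "\<And>k x. 0 \<le> F k x" "\<And>k. fnorm C0 (F k) \<le> (1 / 2) ^ k"
  then show "\<exists>g\<in>funs C0. \<forall>k. \<exists>h\<in>funs C0. ident C0 h (F k) \<and> (\<forall>x\<ge>0. \<bar>h x\<bar> \<le> \<bar>g x\<bar>)"
    by (rule C0_majorant)
next
  fix x y :: real and n :: nat assume xy: "0 \<le> x" "x + 1 \<le> y"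
  then have "0 < v x" "0 < v y"
    using pos by auto
  then have "((M * exp w)\<^sup>2 * v y / v x) powr 1 = (M * exp w)\<^sup>2 * v y / v x"
    by simp
  then show "\<exists>f. \<forall>i<n. f i \<in> funs C0 \<and> (\<forall>z. 0 \<le> f i z) \<and>
             fnorm C0 (f i) \<le> ((M * exp w)\<^sup>2 * v y / v x) powr 1 \<and>
             1 \<le> fnorm C0 (shift (y - 1 - x) (f i)) \<and>
             (\<forall>j<n. i \<noteq> j \<longrightarrow> (\<forall>z. f i z = 0 \<or> f j z = 0))"
    using C0_bumps[OF xy, of n] by simp
qed simp

end

section \<open>Weighted integrable functions\<close>

text \<open>Convexity of \<open>r powr p\<close> on the closed half line: the endpoint \<open>0\<close> is treated separately, using
\<open>c powr p \<le> c\<close> for \<open>c \<le> 1\<close>.\<close>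

lemma powr_convex_combination:
  fixes a b r s p :: real
  assumes "0 \<le> r" "0 \<le> s" "0 < a" "0 < b" "a + b = 1" "1 \<le> p"
  shows "(a * r + b * s) powr p \<le> a * r powr p + b * s powr p"
proof -
  have le: "(c * z) powr p \<le> c * z powr p" if "0 < c" "c \<le> 1" "0 \<le> z" for c z :: real
  proof -
    have "c powr p \<le> c powr 1"
      using that assms by (intro powr_mono') auto
    then have "c powr p * z powr p \<le> c * z powr p"
      using that by (intro mult_right_mono) auto
    then show ?thesis
      using that by (simp add: powr_mult)
  qed
  consider "r = 0" | "s = 0" | "0 < r" "0 < s"
    using assms by linarith
  then show ?thesis
  proof cases
    case 1
    then show ?thesis
      using assms le[of b s] by simp
  next
    case 2
    then show ?thesis
      using assms le[of a r] by simp
  next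
    case 3
    have a: "1 - b = a"
      using assms by simp
    have "((1 - b) *\<^sub>R r + b *\<^sub>R s) powr p \<le> (1 - b) * r powr p + b * s powr p"
      using 3 assms by (intro convex_onD[OF powr_convex[OF assms(6)]]) auto
    then show ?thesis
      unfolding a by simp
  qed
qed

lemma measurable_shift_half_line:
  fixes f :: "real \<Rightarrow> real"
  assumes "f \<in> borel_measurable (lebesgue_on {0..})" "0 \<le> t"
  shows "(\<lambda>x. f (x + t)) \<in> borel_measurable (lebesgue_on {0..})"
proof -
  have "(\<lambda>x::real. x + t) \<in> lebesgue \<rightarrow>\<^sub>M lebesgue"
    using lebesgue_affine_measurable[of "\<lambda>x::real. 1" t] by (simp add: add.commute)
  then have "(\<lambda>x::real. x + t) \<in> lebesgue_on {0..} \<rightarrow>\<^sub>M lebesgue_on {0..}"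
    using assms(2) by (intro measurable_restrict_space3) auto
  from measurable_compose[OF this assms(1)] show ?thesis .
qed

lemma integral_shift_half_line:
  fixes g :: "real \<Rightarrow> real"
  assumes g: "integrable (lebesgue_on {0..}) g" and t: "0 \<le> t"
  shows "integrable (lebesgue_on {0..}) (\<lambda>x. g (x + t))"
    and "(LINT x|lebesgue_on {0..}. g (x + t)) = (LINT x|lebesgue_on {0..}. indicator {t..} x * g x)"
proof -
  define h where "h y = indicator {t..} y * (indicator {0..} y * g y)" for y
  have "integrable lebesgue (\<lambda>y. indicator {0..} y * g y)"
    using g by (simp add: integrable_restrict_space)
  then have "integrable lebesgue (\<lambda>y. indicator {t..} y *\<^sub>R (indicator {0..} y * g y))"
    by (intro integrable_mult_indicator) auto
  then have h: "integrable lebesgue h"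
    unfolding h_def by simp
  have eq: "h (t + 1 * x) = indicator {0..} x *\<^sub>R g (x + t)" for x
    using t by (simp add: h_def indicator_def add.commute)
  show "integrable (lebesgue_on {0..}) (\<lambda>x. g (x + t))"
    using lebesgue_integrable_real_affine[OF h, of 1 t] unfolding eq
    by (simp add: integrable_restrict_space)
  have "(LINT x|lebesgue_on {0..}. g (x + t)) = (LINT x|lebesgue. h x)"
    using lebesgue_integral_real_affine[of 1 h t] unfolding eq
    by (simp add: integral_restrict_space)
  also have "\<dots> = (LINT x|lebesgue_on {0..}. indicator {t..} x * g x)"
    by (simp add: integral_restrict_space h_def mult_ac)
  finally show "(LINT x|lebesgue_on {0..}. g (x + t)) = (LINT x|lebesgue_on {0..}. indicator {t..} x * g x)" .
qed

lemma integral_indicator_half_line: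
  fixes a b c :: real
  assumes "0 \<le> a" "a \<le> b"
  shows "integrable (lebesgue_on {0..}) (\<lambda>x. c * indicator {a<..<b} x)"
    and "(LINT x|lebesgue_on {0..}. c * indicator {a<..<b} x) = c * (b - a)"
proof -
  have eq: "indicator {0..} x * (indicator {a<..<b} x :: real) = indicator {a<..<b} x" for x
    using assms by (auto simp: indicator_def)
  have "integrable lebesgue (\<lambda>x. indicator {a<..<b} x :: real)"
    using assms by (auto simp: integrable_indicator_iff)
  then have "integrable (lebesgue_on {0..}) (\<lambda>x. indicator {a<..<b} x :: real)"
    by (simp add: integrable_restrict_space eq)
  then show "integrable (lebesgue_on {0..}) (\<lambda>x. c * indicator {a<..<b} x)"
    by simp
  have "(LINT x|lebesgue_on {0..}. indicator {a<..<b} x :: real)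
      = (LINT x|lebesgue. indicator {0..} x *\<^sub>R indicator {a<..<b} x)"
    by (rule integral_restrict_space) simp
  also have "\<dots> = b - a"
    using assms by (simp add: eq)
  finally have "(LINT x|lebesgue_on {0..}. indicator {a<..<b} x :: real) = b - a" .
  then show "(LINT x|lebesgue_on {0..}. c * indicator {a<..<b} x) = c * (b - a)"
    by simp
qed

locale Lp_weight = weight +
  fixes p :: real
  assumes p: "1 \<le> p"
    and v_measurable [measurable]: "v \<in> borel_measurable (lebesgue_on {0..})"
begin

abbreviation Lp :: function_space where "Lp \<equiv> Lp_space p v"
abbreviation L :: "real measure" where "L \<equiv> lebesgue_on {0..}"

definition energy :: "(real \<Rightarrow> real) \<Rightarrow> real" where
  "energy f = (LINT x|L. \<bar>f x\<bar> powr p * v x)"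

lemma Lp_mem: "f \<in> funs Lp \<longleftrightarrow> f \<in> borel_measurable L \<and> integrable L (\<lambda>x. \<bar>f x\<bar> powr p * v x)"
  by (simp add: Lp_space_def)

lemma Lp_fnorm: "fnorm Lp f = energy f powr (1 / p)"
  by (simp add: Lp_space_def energy_def)

lemma Lp_ident: "ident Lp f g \<longleftrightarrow> (AE x in L. f x = g x)"
  by (simp add: Lp_space_def)

lemma nonneg_integrand: "x \<in> space L \<Longrightarrow> 0 \<le> \<bar>f x\<bar> powr p * v x"
  using pos[of x] by simp

lemma energy_nonneg: "0 \<le> energy f"
  unfolding energy_def using nonneg_integrand by (intro Bochner_Integration.integral_nonneg) auto

lemma energy_le_powr:
  assumes "fnorm Lp f \<le> a" "0 \<le> a"
  shows "energy f \<le> a powr p"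
proof -
  have "energy f = fnorm Lp f powr p"
    using p energy_nonneg by (simp add: Lp_fnorm powr_powr)
  also have "\<dots> \<le> a powr p"
    using assms p by (intro powr_mono2) (auto simp: Lp_fnorm)
  finally show ?thesis .
qed

lemma fnorm_le_powr:
  assumes "energy f \<le> b"
  shows "fnorm Lp f \<le> b powr (1 / p)"
  unfolding Lp_fnorm using assms p energy_nonneg by (intro powr_mono2) auto

lemma Lp_dominated:
  assumes [measurable]: "f \<in> borel_measurable L" and g: "integrable L g"
    and le: "\<And>x. 0 \<le> x \<Longrightarrow> \<bar>f x\<bar> powr p * v x \<le> g x"
  shows "f \<in> funs Lp" "energy f \<le> (LINT x|L. g x)"
proof -
  have "integrable L (\<lambda>x. \<bar>f x\<bar> powr p * v x)"
    using g
  proof (rule Bochner_Integration.integrable_bound)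
    show "AE x in L. norm (\<bar>f x\<bar> powr p * v x) \<le> norm (g x)"
    proof (rule AE_I2)
      fix x assume x: "x \<in> space L"
      then show "norm (\<bar>f x\<bar> powr p * v x) \<le> norm (g x)"
        using le[of x] nonneg_integrand[OF x, of f] by simp
    qed
  qed measurable
  then show "f \<in> funs Lp"
    by (simp add: Lp_mem)
  show "energy f \<le> (LINT x|L. g x)"
    unfolding energy_def using \<open>integrable L (\<lambda>x. \<bar>f x\<bar> powr p * v x)\<close> g le
    by (intro integral_mono) auto
qed

lemma Lp_solid:
  assumes "f \<in> funs Lp" "g \<in> funs Lp" "\<And>x. 0 \<le> x \<Longrightarrow> \<bar>f x\<bar> \<le> \<bar>g x\<bar>"
  shows "fnorm Lp f \<le> fnorm Lp g"
proof -
  have "\<bar>f x\<bar> powr p * v x \<le> \<bar>g x\<bar> powr p * v x" if "0 \<le> x" for x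
    using assms(3)[OF that] pos[OF that] p by (intro mult_right_mono powr_mono2) auto
  then have "energy f \<le> energy g"
    using Lp_dominated(2)[of f "\<lambda>x. \<bar>g x\<bar> powr p * v x"] assms(1,2)
    by (simp add: Lp_mem energy_def)
  then have "fnorm Lp f \<le> energy g powr (1 / p)"
    by (rule fnorm_le_powr)
  then show ?thesis
    by (simp add: Lp_fnorm)
qed

text \<open>Minkowski's inequality. The modulus \<open>\<bar>f\<bar> + \<bar>g\<bar>\<close> is \<open>a + b\<close> times the convex combination of \<open>\<bar>f\<bar> / a\<close> and
\<open>\<bar>g\<bar> / b\<close> with the weights \<open>a / (a + b)\<close> and \<open>b / (a + b)\<close>; convexity of the power is then integrated.
Positive bounds \<open>a\<close> and \<open>b\<close> instead of the norms themselves avoid a division by \<open>0\<close>.\<close>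

lemma Lp_diff_energy:
  assumes f: "f \<in> funs Lp" and g: "g \<in> funs Lp" and ab: "0 < a" "0 < b"
    and le: "energy f \<le> a powr p" "energy g \<le> b powr p"
  shows "(\<lambda>x. f x - g x) \<in> funs Lp" "energy (\<lambda>x. f x - g x) \<le> (a + b) powr p"
proof -
  define c where "c = a / (a + b)"
  define d where "d = b / (a + b)"
  have cd: "0 < c" "0 < d" "c + d = 1"
    using ab by (simp_all add: c_def d_def add_divide_distrib[symmetric])
  have sc: "(a + b) * c = a" "(a + b) * d = b"
    using ab by (simp_all add: c_def d_def)
  define G where "G x = (a + b) powr p * (c / a powr p * (\<bar>f x\<bar> powr p * v x) + d / b powr p * (\<bar>g x\<bar> powr p * v x))" for x
  have int: "integrable L (\<lambda>x. \<bar>f x\<bar> powr p * v x)" "integrable L (\<lambda>x. \<bar>g x\<bar> powr p * v x)"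
    and meas: "f \<in> borel_measurable L" "g \<in> borel_measurable L"
    using f g by (auto simp: Lp_mem)
  have G: "integrable L G"
    unfolding G_def using int by auto
  have le_G: "\<bar>f x - g x\<bar> powr p * v x \<le> G x" if x: "0 \<le> x" for x
  proof -
    have "\<bar>f x - g x\<bar> \<le> \<bar>f x\<bar> + \<bar>g x\<bar>"
      by simp
    also have "\<dots> = (a + b) * (c * (\<bar>f x\<bar> / a) + d * (\<bar>g x\<bar> / b))"
      using sc ab by (simp add: distrib_left mult.assoc[symmetric])
    finally have "\<bar>f x - g x\<bar> powr p \<le> ((a + b) * (c * (\<bar>f x\<bar> / a) + d * (\<bar>g x\<bar> / b))) powr p"
      using p by (intro powr_mono2) auto
    also have "\<dots> = (a + b) powr p * (c * (\<bar>f x\<bar> / a) + d * (\<bar>g x\<bar> / b)) powr p"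
      using ab cd by (intro powr_mult)
    also have "\<dots> \<le> (a + b) powr p * (c * (\<bar>f x\<bar> / a) powr p + d * (\<bar>g x\<bar> / b) powr p)"
      using ab cd p by (intro mult_left_mono powr_convex_combination) auto
    finally have "\<bar>f x - g x\<bar> powr p * v x \<le>
        ((a + b) powr p * (c * (\<bar>f x\<bar> / a) powr p + d * (\<bar>g x\<bar> / b) powr p)) * v x"
      using pos[OF x] by (intro mult_right_mono) auto
    also have "\<dots> = G x"
      using ab by (simp add: G_def powr_divide algebra_simps)
    finally show ?thesis .
  qed
  note * = Lp_dominated[OF borel_measurable_diff[OF meas] G le_G]
  show "(\<lambda>x. f x - g x) \<in> funs Lp"
    by (rule *(1))
  have "energy (\<lambda>x. f x - g x) \<le> (LINT x|L. G x)"
    by (rule *(2))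
  also have "\<dots> = (a + b) powr p * (c / a powr p * energy f + d / b powr p * energy g)"
    unfolding G_def energy_def using int by simp
  also have "\<dots> \<le> (a + b) powr p * (c / a powr p * a powr p + d / b powr p * b powr p)"
    using ab cd le by (intro mult_left_mono add_mono) auto
  also have "\<dots> = (a + b) powr p"
    using ab cd by simp
  finally show "energy (\<lambda>x. f x - g x) \<le> (a + b) powr p" .
qed

lemma Lp_diff:
  assumes f: "f \<in> funs Lp" and g: "g \<in> funs Lp"
  shows "(\<lambda>x. f x - g x) \<in> funs Lp" "fnorm Lp (\<lambda>x. f x - g x) \<le> fnorm Lp f + fnorm Lp g"
proof -
  have bound: "(\<lambda>x. f x - g x) \<in> funs Lp \<and> fnorm Lp (\<lambda>x. f x - g x) \<le> fnorm Lp f + fnorm Lp g + e"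
    if e: "0 < e" for e
  proof -
    define a where "a = fnorm Lp f + e / 2"
    define b where "b = fnorm Lp g + e / 2"
    have ab: "0 < a" "0 < b" "fnorm Lp f \<le> a" "fnorm Lp g \<le> b"
      using e by (auto simp: a_def b_def Lp_fnorm add_nonneg_pos)
    note * = Lp_diff_energy[OF f g ab(1,2) energy_le_powr[OF ab(3)] energy_le_powr[OF ab(4)]]
    have "fnorm Lp (\<lambda>x. f x - g x) \<le> ((a + b) powr p) powr (1 / p)"
      using ab by (intro fnorm_le_powr *(2)) auto
    also have "\<dots> = fnorm Lp f + fnorm Lp g + e"
      using ab p by (simp add: powr_powr) (simp add: a_def b_def)
    finally show ?thesis
      using *(1) ab by auto
  qed
  show "(\<lambda>x. f x - g x) \<in> funs Lp"
    using bound[of 1] by simp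
  show "fnorm Lp (\<lambda>x. f x - g x) \<le> fnorm Lp f + fnorm Lp g"
    by (rule field_le_epsilon) (use bound in blast)
qed

lemma Lp_ident_iff:
  assumes "f \<in> funs Lp" "g \<in> funs Lp"
  shows "ident Lp f g \<longleftrightarrow> fnorm Lp (\<lambda>x. f x - g x) = 0"
proof -
  have int: "integrable L (\<lambda>x. \<bar>f x - g x\<bar> powr p * v x)"
    using Lp_diff(1)[OF assms] by (simp add: Lp_mem)
  have "fnorm Lp (\<lambda>x. f x - g x) = 0 \<longleftrightarrow> energy (\<lambda>x. f x - g x) = 0"
    by (simp add: Lp_fnorm)
  also have "\<dots> \<longleftrightarrow> (AE x in L. \<bar>f x - g x\<bar> powr p * v x = 0)"
    unfolding energy_def
    by (rule integral_nonneg_eq_0_iff_AE[OF int]) (intro AE_I2 nonneg_integrand)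
  also have "\<dots> \<longleftrightarrow> (AE x in L. f x = g x)"
  proof (rule AE_cong)
    fix x assume "x \<in> space L"
    then have "0 < v x"
      using pos by simp
    then show "(\<bar>f x - g x\<bar> powr p * v x = 0) = (f x = g x)"
      by (simp only: mult_eq_0_iff powr_eq_0_iff) auto
  qed
  finally show ?thesis
    by (simp add: Lp_ident)
qed

lemma Lp_shift:
  assumes f: "f \<in> funs Lp" and t: "0 \<le> t" and R: "\<And>x. 0 \<le> x \<Longrightarrow> v x \<le> R * v (x + t)"
  shows "shift t f \<in> funs Lp"
    and "energy (shift t f) \<le> R * (LINT x|L. indicator {t..} x * (\<bar>f x\<bar> powr p * v x))"
proof -
  have int: "integrable L (\<lambda>x. \<bar>f x\<bar> powr p * v x)" and meas: "f \<in> borel_measurable L"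
    using f by (auto simp: Lp_mem)
  have int_R: "integrable L (\<lambda>x. R * (\<bar>f (x + t)\<bar> powr p * v (x + t)))"
    using integral_shift_half_line(1)[OF int t] by (rule integrable_mult_right)
  have le_R: "\<bar>f (x + t)\<bar> powr p * v x \<le> R * (\<bar>f (x + t)\<bar> powr p * v (x + t))" if "0 \<le> x" for x
    using mult_left_mono[OF R[OF that], of "\<bar>f (x + t)\<bar> powr p"] by (simp add: mult_ac)
  note * = Lp_dominated[OF measurable_shift_half_line[OF meas t] int_R le_R]
  show "shift t f \<in> funs Lp"
    by (rule *(1))
  show "energy (shift t f) \<le> R * (LINT x|L. indicator {t..} x * (\<bar>f x\<bar> powr p * v x))"
    using *(2) integral_shift_half_line(2)[OF int t] by simp
qed

lemma ratio_nonneg: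
  assumes t: "0 \<le> t" and R: "\<And>x. 0 \<le> x \<Longrightarrow> v x \<le> R * v (x + t)"
  shows "0 \<le> R"
proof -
  have "0 < R * v (0 + t)"
    using R[of 0] pos[of 0] by simp
  then show ?thesis
    using pos[of t] t by (simp add: zero_less_mult_iff)
qed

lemma Lp_shift_le:
  assumes f: "f \<in> funs Lp" and t: "0 \<le> t" and R: "\<And>x. 0 \<le> x \<Longrightarrow> v x \<le> R * v (x + t)"
  shows "fnorm Lp (shift t f) \<le> R powr (1 / p) * fnorm Lp f"
proof -
  have R0: "0 \<le> R"
    using ratio_nonneg[OF t R] .
  have int: "integrable L (\<lambda>x. \<bar>f x\<bar> powr p * v x)"
    using f by (auto simp: Lp_mem)
  have "(LINT x|L. indicator {t..} x * (\<bar>f x\<bar> powr p * v x)) \<le> energy f"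
    unfolding energy_def
  proof (rule integral_mono)
    show "integrable L (\<lambda>x. indicator {t..} x * (\<bar>f x\<bar> powr p * v x))"
      using integrable_mult_indicator[OF _ int, of "{t..}"] t by (simp add: sets_restrict_space_iff)
    show "indicator {t..} x * (\<bar>f x\<bar> powr p * v x) \<le> \<bar>f x\<bar> powr p * v x" if "x \<in> space L" for x
      using nonneg_integrand[OF that, of f] by (simp add: indicator_def)
  qed (rule int)
  then have "energy (shift t f) \<le> R * energy f"
    using Lp_shift(2)[OF f t R] R0 by (meson mult_left_mono order.trans)
  then have "fnorm Lp (shift t f) \<le> (R * energy f) powr (1 / p)"
    by (rule fnorm_le_powr)
  then show ?thesis
    using R0 energy_nonneg by (simp add: powr_mult Lp_fnorm)
qed

lemma Lp_shift_tendsto: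
  assumes f: "f \<in> funs Lp" and R: "\<And>x y. 0 \<le> x \<Longrightarrow> x \<le> y \<Longrightarrow> v x \<le> R * v y"
  shows "((\<lambda>t. fnorm Lp (shift t f)) \<longlongrightarrow> 0) at_top"
proof -
  let ?g = "\<lambda>x. \<bar>f x\<bar> powr p * v x"
  let ?tail = "\<lambda>t::real. LINT x|L. indicator {t..} x * ?g x"
  have int: "integrable L ?g" and [measurable]: "f \<in> borel_measurable L"
    using f by (auto simp: Lp_mem)
  have "(?tail \<longlongrightarrow> (LINT x|L. 0)) at_top"
  proof (rule integral_dominated_convergence_at_top[where w = ?g])
    show "(\<lambda>x. indicator {t..} x * ?g x) \<in> borel_measurable L" for t :: real
      by (intro borel_measurable_times borel_measurable_integrable[OF int]
          measurable_restrict_space1 borel_measurable_indicator) auto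
    show "AE x in L. ((\<lambda>t. indicator {t..} x * ?g x) \<longlongrightarrow> 0) at_top"
    proof (rule AE_I2)
      fix x :: real
      have "\<forall>\<^sub>F t in at_top. 0 = indicator {t..} x * ?g x"
        using eventually_gt_at_top[of x] by eventually_elim simp
      then show "((\<lambda>t. indicator {t..} x * ?g x) \<longlongrightarrow> 0) at_top"
        by (rule Lim_transform_eventually[OF tendsto_const])
    qed
    have "norm (indicator {t..} x * ?g x) \<le> ?g x" if "x \<in> space L" for t x :: real
      using nonneg_integrand[OF that, of f] by (simp add: indicator_def)
    then show "\<forall>\<^sub>F t in at_top. AE x in L. norm (indicator {t..} x * ?g x) \<le> ?g x"
      by (intro always_eventually allI AE_I2)
  qed (use int in auto)
  then have tail: "((\<lambda>t. R * ?tail t) \<longlongrightarrow> 0) at_top"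
    by (intro tendsto_mult_right_zero) simp
  have "((\<lambda>t. energy (shift t f)) \<longlongrightarrow> 0) at_top"
  proof (rule tendsto_sandwich[OF _ _ tendsto_const tail])
    show "\<forall>\<^sub>F t in at_top. 0 \<le> energy (shift t f)"
      using energy_nonneg by simp
    show "\<forall>\<^sub>F t in at_top. energy (shift t f) \<le> R * ?tail t"
      using eventually_ge_at_top[of 0] by eventually_elim (intro Lp_shift(2) f R, auto)
  qed
  then have "((\<lambda>t. energy (shift t f) powr (1 / p)) \<longlongrightarrow> 0 powr (1 / p)) at_top"
    using p energy_nonneg by (intro tendsto_powr2) auto
  then show ?thesis
    by (simp add: Lp_fnorm)
qed

text \<open>The majorant is the \<open>p\<close>-th root of \<open>\<Sum>k. \<bar>F k x\<bar> powr p\<close>. The integrals of the summands are at most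
\<open>(1 / 2) ^ k\<close>, so by monotone convergence the series converges almost everywhere and has a finite
weighted integral.\<close>

lemma Lp_majorant:
  assumes F: "\<And>k. F k \<in> funs Lp" "\<And>k. fnorm Lp (F k) \<le> (1 / 2) ^ k"
  shows "\<exists>g\<in>funs Lp. \<forall>k::nat. \<exists>h\<in>funs Lp. ident Lp h (F k) \<and> (\<forall>x\<ge>0. \<bar>h x\<bar> \<le> \<bar>g x\<bar>)"
proof -
  have int: "integrable L (\<lambda>x. \<bar>F k x\<bar> powr p * v x)" and [measurable]: "F k \<in> borel_measurable L" for k
    using F(1)[of k] by (auto simp: Lp_mem)
  have geo: "summable (\<lambda>k. (1 / 2 :: real) ^ k)"
    by (rule summable_geometric) simp
  have small: "energy (F k) \<le> (1 / 2) ^ k" for k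
  proof -
    have "energy (F k) \<le> ((1 / 2) ^ k) powr p"
      by (rule energy_le_powr[OF F(2)]) simp
    also have "\<dots> \<le> ((1 / 2) ^ k) powr 1"
      using p by (intro powr_mono') (auto simp: power_le_one)
    finally show ?thesis
      by simp
  qed
  have sum_energy: "summable (\<lambda>k. energy (F k))"
    using small energy_nonneg by (intro summable_comparison_test[OF _ geo]) auto
  have nn: "(\<integral>\<^sup>+x. ennreal (\<bar>F k x\<bar> powr p * v x) \<partial>L) = ennreal (energy (F k))" for k
    unfolding energy_def by (intro nn_integral_eq_integral int AE_I2 nonneg_integrand)
  have "(\<integral>\<^sup>+x. (\<Sum>k. ennreal (\<bar>F k x\<bar> powr p * v x)) \<partial>L) = (\<Sum>k. ennreal (energy (F k)))"
    by (subst nn_integral_suminf) (auto simp: nn)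
  also have "\<dots> \<noteq> \<infinity>"
    using sum_energy energy_nonneg by (simp add: suminf_ennreal2)
  finally have "AE x in L. (\<Sum>k. ennreal (\<bar>F k x\<bar> powr p * v x)) \<noteq> \<infinity>"
    by (intro nn_integral_PInf_AE) auto
  then have sum: "AE x in L. summable (\<lambda>k. \<bar>F k x\<bar> powr p)"
  proof (rule AE_mp, intro AE_I2 impI)
    fix x assume x: "x \<in> space L" and fin: "(\<Sum>k. ennreal (\<bar>F k x\<bar> powr p * v x)) \<noteq> \<infinity>"
    have "summable (\<lambda>k. \<bar>F k x\<bar> powr p * v x)"
      using fin nonneg_integrand[OF x] by (intro summable_suminf_not_top) (auto simp: top_ennreal_def)
    then show "summable (\<lambda>k. \<bar>F k x\<bar> powr p)"
      using pos[of x] x summable_mult2[of "\<lambda>k. \<bar>F k x\<bar> powr p * v x" "1 / v x"] by simp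
  qed
  \<comment> \<open>the absolute value keeps \<open>S\<close> nonnegative where the series diverges and its sum is unspecified\<close>
  define S where "S x = \<bar>\<Sum>k. \<bar>F k x\<bar> powr p\<bar>" for x
  define g where "g x = S x powr (1 / p)" for x
  have [measurable]: "S \<in> borel_measurable L"
    unfolding S_def by measurable
  have gS: "\<bar>g x\<bar> powr p = S x" for x
    using p by (simp add: g_def S_def powr_powr)
  have Sv: "AE x in L. S x * v x = (\<Sum>k. \<bar>F k x\<bar> powr p * v x)"
    using sum
  proof (rule AE_mp, intro AE_I2 impI)
    fix x assume "summable (\<lambda>k. \<bar>F k x\<bar> powr p)"
    then show "S x * v x = (\<Sum>k. \<bar>F k x\<bar> powr p * v x)"
      using suminf_mult2[of "\<lambda>k. \<bar>F k x\<bar> powr p" "v x"] suminf_nonneg[of "\<lambda>k. \<bar>F k x\<bar> powr p"]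
      by (simp add: S_def)
  qed
  have "integrable L (\<lambda>x. \<Sum>k. \<bar>F k x\<bar> powr p * v x)"
  proof (rule integrable_suminf[OF int])
    show "AE x in L. summable (\<lambda>k. norm (\<bar>F k x\<bar> powr p * v x))"
      using sum
    proof (rule AE_mp, intro AE_I2 impI)
      fix x assume x: "x \<in> space L" and s: "summable (\<lambda>k. \<bar>F k x\<bar> powr p)"
      show "summable (\<lambda>k. norm (\<bar>F k x\<bar> powr p * v x))"
        using summable_mult2[OF s, of "v x"] pos[of x] x by (simp add: abs_mult)
    qed
    have "(LINT x|L. norm (\<bar>F k x\<bar> powr p * v x)) = energy (F k)" for k
      unfolding energy_def
      by (intro Bochner_Integration.integral_cong refl)
        (simp only: real_norm_def abs_of_nonneg[OF nonneg_integrand])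
    then show "summable (\<lambda>k. LINT x|L. norm (\<bar>F k x\<bar> powr p * v x))"
      using sum_energy by simp
  qed
  then have "integrable L (\<lambda>x. S x * v x)"
    using Sv by (subst integrable_cong_AE[OF _ _ Sv]) auto
  moreover have "g \<in> borel_measurable L"
    unfolding g_def by measurable
  ultimately have g: "g \<in> funs Lp"
    by (simp add: Lp_mem gS)
  \<comment> \<open>where the series diverges, \<open>g\<close> says nothing about \<open>F k\<close>, so \<open>F k\<close> is altered on a null set\<close>
  define h where "h k x = (if \<bar>F k x\<bar> \<le> \<bar>g x\<bar> then F k x else 0)" for k x
  have "\<exists>h\<in>funs Lp. ident Lp h (F k) \<and> (\<forall>x\<ge>0. \<bar>h x\<bar> \<le> \<bar>g x\<bar>)" for k
  proof (intro bexI[of _ "h k"] conjI)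
    have [measurable]: "g \<in> borel_measurable L"
      by fact
    have "h k \<in> borel_measurable L"
      unfolding h_def by measurable
    moreover have "\<bar>h k x\<bar> powr p * v x \<le> \<bar>F k x\<bar> powr p * v x" if "0 \<le> x" for x
      using pos[OF that] by (simp add: h_def)
    ultimately show "h k \<in> funs Lp"
      by (rule Lp_dominated(1)[OF _ int[of k]])
    show "\<forall>x\<ge>0. \<bar>h k x\<bar> \<le> \<bar>g x\<bar>"
      by (simp add: h_def)
    show "ident Lp (h k) (F k)"
      unfolding Lp_ident using sum
    proof (rule AE_mp, intro AE_I2 impI)
      fix x assume s: "summable (\<lambda>k. \<bar>F k x\<bar> powr p)"
      have "\<bar>F k x\<bar> powr p = (\<Sum>i\<in>{k}. \<bar>F i x\<bar> powr p)"
        by simp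
      also have "\<dots> \<le> (\<Sum>i. \<bar>F i x\<bar> powr p)"
        using s by (intro sum_le_suminf) auto
      also have "\<dots> \<le> S x"
        by (simp add: S_def)
      finally have "(\<bar>F k x\<bar> powr p) powr (1 / p) \<le> S x powr (1 / p)"
        using p by (intro powr_mono2) auto
      then have "\<bar>F k x\<bar> \<le> \<bar>g x\<bar>"
        using p by (simp add: powr_powr g_def)
      then show "h k x = F k x"
        by (simp add: h_def)
    qed
  qed
  then show ?thesis
    using g by blast
qed

lemma Lp_step_function:
  assumes ab: "0 \<le> a" "a \<le> b" and c: "0 \<le> c"
  shows "(\<lambda>x. c * indicator {a<..<b} x) \<in> funs Lp"
    and "(\<And>x. a < x \<Longrightarrow> x < b \<Longrightarrow> v x \<le> V) \<Longrightarrow>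
      energy (\<lambda>x. c * indicator {a<..<b} x) \<le> c powr p * V * (b - a)"
    and "(\<And>x. a < x \<Longrightarrow> x < b \<Longrightarrow> V \<le> v x) \<Longrightarrow>
      c powr p * V * (b - a) \<le> energy (\<lambda>x. c * indicator {a<..<b} x)"
proof -
  let ?f = "\<lambda>x. c * indicator {a<..<b} x :: real"
  have f: "\<bar>?f x\<bar> powr p * v x = c powr p * v x * indicator {a<..<b} x" for x
    using c p by (auto simp: indicator_def)
  have meas: "?f \<in> borel_measurable L"
    using integral_indicator_half_line(1)[OF ab] by (rule borel_measurable_integrable)
  have step: "?f \<in> funs Lp \<and> energy ?f \<le> c powr p * V * (b - a)"
    if V: "\<And>x. a < x \<Longrightarrow> x < b \<Longrightarrow> v x \<le> V" for V
  proof -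
    have "\<bar>?f x\<bar> powr p * v x \<le> c powr p * V * indicator {a<..<b} x" if "0 \<le> x" for x
      unfolding f using V[of x] by (auto simp: indicator_def intro: mult_left_mono)
    from Lp_dominated[OF meas integral_indicator_half_line(1)[OF ab] this] show ?thesis
      unfolding integral_indicator_half_line(2)[OF ab] by simp
  qed
  show "(\<And>x. a < x \<Longrightarrow> x < b \<Longrightarrow> v x \<le> V) \<Longrightarrow> energy ?f \<le> c powr p * V * (b - a)"
    using step by blast
  have "v x \<le> M * exp (w * b) * v b" if "a < x" "x < b" for x
    using le_growth[of x b b] that ab by simp
  from step[OF this] show mem: "?f \<in> funs Lp"
    by blast
  show "c powr p * V * (b - a) \<le> energy ?f" if V: "\<And>x. a < x \<Longrightarrow> x < b \<Longrightarrow> V \<le> v x"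
  proof -
    have "(LINT x|L. c powr p * V * indicator {a<..<b} x) \<le> energy ?f"
      unfolding energy_def
    proof (rule integral_mono)
      show "c powr p * V * indicator {a<..<b} x \<le> \<bar>?f x\<bar> powr p * v x" for x
        unfolding f using V[of x] by (auto simp: indicator_def intro: mult_left_mono)
    qed (use mem integral_indicator_half_line(1)[OF ab] in \<open>auto simp: Lp_mem\<close>)
    then show ?thesis
      unfolding integral_indicator_half_line(2)[OF ab] .
  qed
qed

text \<open>The bumps are multiples of the indicators of the \<open>n\<close> subintervals of \<open>[y - 1, y]\<close> of length \<open>1 / n\<close>. The
factor \<open>c\<close> is such that \<open>c powr p\<close> compensates for this length and for the smallest value
\<open>v x / K\<close> that the growth condition allows for the weight on \<open>[x, x + 1]\<close>.\<close>

lemma Lp_bumps: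
  assumes x: "0 \<le> x" and xy: "x + 1 \<le> y"
  shows "\<exists>f. \<forall>i<n::nat. f i \<in> funs Lp \<and> (\<forall>z. 0 \<le> f i z) \<and>
             fnorm Lp (f i) \<le> ((M * exp w)\<^sup>2 * v y / v x) powr (1 / p) \<and>
             1 \<le> fnorm Lp (shift (y - 1 - x) (f i)) \<and>
             (\<forall>j<n. i \<noteq> j \<longrightarrow> (\<forall>z. f i z = 0 \<or> f j z = 0))"
proof -
  define K where "K = M * exp w"
  define c where "c = (real n * K / v x) powr (1 / p)"
  define f where "f i z = c * indicator {y - 1 + real i / real n <..< y - 1 + real (Suc i) / real n} z"
    for i :: nat and z :: real
  have K: "0 < K"
    using M_ge by (simp add: K_def)
  have vx: "0 < v x"
    using pos x by simp
  have c0: "0 \<le> c"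
    by (simp add: c_def)
  have props: "f i \<in> funs Lp \<and> (\<forall>z. 0 \<le> f i z) \<and>
             fnorm Lp (f i) \<le> (K\<^sup>2 * v y / v x) powr (1 / p) \<and>
             1 \<le> fnorm Lp (shift (y - 1 - x) (f i)) \<and>
             (\<forall>j<n. i \<noteq> j \<longrightarrow> (\<forall>z. f i z = 0 \<or> f j z = 0))" if i: "i < n" for i
  proof (intro conjI allI impI)
    have n: "0 < real n"
      using i by simp
    have cp: "c powr p = real n * K / v x"
      using p n K vx by (simp add: c_def powr_powr)
    define l where "l = real i / real n"
    define u where "u = real (Suc i) / real n"
    have lu: "0 \<le> l" "l \<le> u" "u \<le> 1" "u - l = 1 / real n"
      using i n by (auto simp: l_def u_def field_simps)
    have f: "f i = (\<lambda>z. c * indicator {y - 1 + l<..<y - 1 + u} z)"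
      by (rule ext) (simp only: f_def l_def u_def)
    show "0 \<le> f i z" for z
      using c0 by (simp add: f_def)
    show "f i \<in> funs Lp"
      unfolding f using x xy lu c0 by (intro Lp_step_function(1)) auto
    have "energy (f i) \<le> c powr p * (K * v y) * (y - 1 + u - (y - 1 + l))"
      unfolding f
    proof (rule Lp_step_function(2))
      fix z assume "y - 1 + l < z" "z < y - 1 + u"
      then show "v z \<le> K * v y"
        using le_growth[of z y 1] lu x xy by (simp add: K_def)
    qed (use x xy lu c0 in auto)
    also have "\<dots> = K\<^sup>2 * v y / v x"
      using lu(4) n cp by (simp add: power2_eq_square)
    finally show "fnorm Lp (f i) \<le> (K\<^sup>2 * v y / v x) powr (1 / p)"
      by (rule fnorm_le_powr)
    have sf: "shift (y - 1 - x) (f i) = (\<lambda>z. c * indicator {x + l<..<x + u} z)"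
      unfolding f by (auto simp: fun_eq_iff indicator_def)
    have "1 = c powr p * (v x / K) * (x + u - (x + l))"
      using lu(4) n cp K vx by simp
    also have "\<dots> \<le> energy (shift (y - 1 - x) (f i))"
      unfolding sf
    proof (rule Lp_step_function(3))
      fix z assume "x + l < z" "z < x + u"
      then have "v x \<le> K * v z"
        using le_growth[of x z 1] lu x by (simp add: K_def)
      then show "v x / K \<le> v z"
        using K by (simp add: pos_divide_le_eq mult.commute)
    qed (use x lu c0 in auto)
    finally show "1 \<le> fnorm Lp (shift (y - 1 - x) (f i))"
      unfolding Lp_fnorm using p by (intro ge_one_powr_ge_zero) auto
    fix j z assume j: "j < n" "i \<noteq> j"
    have sep: "z \<le> y - 1 + real b / real n \<or> y - 1 + real (Suc a) / real n \<le> z" if "a < b" for a b :: nat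
    proof -
      have "real (Suc a) / real n \<le> real b / real n"
        using that by (intro divide_right_mono) auto
      then show ?thesis
        by linarith
    qed
    have "i < j \<or> j < i"
      using j by auto
    then show "f i z = 0 \<or> f j z = 0"
      using sep[of i j] sep[of j i] by (auto simp: f_def indicator_def)
  qed
  show ?thesis
    using props unfolding K_def by blast
qed

sublocale Lp: weighted_translation_space "Lp_space p v" v M w "1 / p"
proof
  show "0 < 1 / p"
    using p by simp
  show "(\<lambda>x. 0) \<in> funs Lp"
    using p by (simp add: Lp_mem)
  show "fnorm Lp (\<lambda>x. 0) = 0"
    using p by (simp add: Lp_fnorm energy_def)
  show "0 \<le> fnorm Lp f" for f
    by (simp add: Lp_fnorm)
  show "shift t f \<in> funs Lp" if "f \<in> funs Lp" "0 \<le> t" for t f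
    using growth that by (intro Lp_shift(1)[where R = "M * exp (w * t)"]) auto
  show "\<exists>c. \<forall>f\<in>funs Lp. fnorm Lp (shift t f) \<le> c * fnorm Lp f" if "0 \<le> t" for t
    using growth that by (intro exI[of _ "(M * exp (w * t)) powr (1 / p)"] ballI Lp_shift_le) auto
  fix f g assume "f \<in> funs Lp" "g \<in> funs Lp"
  then show "(\<lambda>x. f x - g x) \<in> funs Lp"
    and "fnorm Lp (\<lambda>x. f x - g x) \<le> fnorm Lp f + fnorm Lp g"
    and "ident Lp f g \<longleftrightarrow> fnorm Lp (\<lambda>x. f x - g x) = 0"
    by (rule Lp_diff Lp_ident_iff)+
qed (rule Lp_solid Lp_shift_le Lp_shift_tendsto Lp_majorant Lp_bumps; assumption)+

end

lemma locally_integrable_imp_measurable: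
  fixes v :: "real \<Rightarrow> real"
  assumes "\<And>K. compact K \<Longrightarrow> K \<subseteq> {0..} \<Longrightarrow> v absolutely_integrable_on K"
  shows "v \<in> borel_measurable (lebesgue_on {0..})"
proof -
  have "(\<lambda>x. indicator {0..real n} x *\<^sub>R v x) \<in> borel_measurable lebesgue" for n :: nat
    using assms[of "{0..real n}"] unfolding set_integrable_def by (intro borel_measurable_integrable) auto
  moreover have "(\<lambda>n. indicator {0..real n} x *\<^sub>R v x) \<longlonglongrightarrow> indicator {0..} x *\<^sub>R v x" for x
  proof (rule tendsto_eventually)
    obtain N :: nat where "x \<le> real N"
      using real_arch_simple by blast
    show "\<forall>\<^sub>F n in sequentially. indicator {0..real n} x *\<^sub>R v x = indicator {0..} x *\<^sub>R v x"
      using eventually_ge_at_top[of N]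
    proof eventually_elim
      case (elim n)
      then have "x \<le> real n"
        using \<open>x \<le> real N\<close> by linarith
      then show ?case
        by (simp add: indicator_def)
    qed
  qed
  ultimately have "(\<lambda>x. indicator {0..} x *\<^sub>R v x) \<in> borel_measurable lebesgue"
    by (rule borel_measurable_LIMSEQ_metric)
  then show ?thesis
    by (simp add: borel_measurable_restrict_space_iff)
qed

section \<open>Characterizations of an unbounded translation semigroup\<close>

theorem mainTheorem1:
  fixes v :: "real \<Rightarrow> real" and X :: function_space
  assumes "admissible_weight v"
    and "(\<exists>p::real. 1 \<le> p \<and> X = Lp_space p v) \<or> X = C0_space v"
  shows "all_equivalent
    [(SUP (x, y)\<in>{(x, y). 0 \<le> x \<and> x \<le> y}. ereal (v x / v y)) = \<infinity>,
     \<exists>f\<in>points X. \<not> limitin (norm_topology X) (\<lambda>t. left_translation X t f) (pzero X) at_top,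
     \<not> uniformly_bounded X (translation_semigroup X),
     \<not> uniformly_equicontinuous X (translation_semigroup X),
     \<not> equicontinuous X (translation_semigroup X),
     topological_entropy X \<noteq> 0,
     topological_entropy X = \<infinity>]"
proof -
  obtain M w where "1 \<le> M" "0 \<le> w" "\<forall>x\<ge>0. \<forall>t\<ge>0. v x \<le> M * exp (w * t) * v (x + t)" "\<forall>x\<ge>0. 0 < v x"
    using assms(1) unfolding admissible_weight_def by blast
  then interpret weight v M w
    by unfold_locales auto
  from assms(2) show ?thesis
  proof (elim disjE exE conjE)
    fix p assume p: "1 \<le> p" and X: "X = Lp_space p v"
    have "v \<in> borel_measurable (lebesgue_on {0..})"
      using assms(1) unfolding admissible_weight_def
      by (intro locally_integrable_imp_measurable) blast
    with p interpret Lp_weight v M w p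
      by unfold_locales
    show ?thesis
      unfolding X by (rule Lp.all_equivalent_translations)
  next
    assume X: "X = C0_space v"
    interpret C0_weight v M w
      by unfold_locales
    show ?thesis
      unfolding X by (rule C0.all_equivalent_translations)
  qed
qed

end
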